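(* Let $A$ be a non-trivial finitely generated group and $S_A$ a finite symmetric generating set of $A$ such that $(A,S_A)$ has unbounded depth. Let $H$ and $K$ be non-trivial finite groups with finite symmetric generating sets $S_H$ and $S_K$, respectively. Then $(A\wr (H*K), S_A\cup S_H\cup S_K)$ has uniformly bounded depth if and only if $$\mathscr{H}(H,S_H)+\mathscr{H}(K,S_K)\ge 1.$$
   Context: For a group $G$ with finite symmetric generating set $S$, $\|g\|_S$ denotes the word length of $g\in G$. An element $g\in G$ is a dead end of $(G,S)$ if $\|gs\|_S\le \|g\|_S$ for all $s\in S$; its depth is the maximal $n\ge 1$ such that $\|gs_1\cdots s_k\|_S\le \|g\|_S$ for all $k\le n$ and all $s_1,\dots,s_k\in S$ (the depth is infinite if there is no maximal such $n$, which can happen only when $G$ is finite). $(G,S)$ has unbounded depth if for every $n\in\mathbb{N}$ there is a dead end of depth at least $n$ (in particular every finite group has unbounded depth); otherwise it has uniformly bounded depth. The wreath product $A\wr B$ is $\bigoplus_B A\rtimes B$, where $\bigoplus_B A$ is the group of finitely supported functions $f:B\to A$ with pointwise multiplication and $B$ acts by $(b\cdot f)(x)=f(b^{-1}x)$; so $(f,b)(f',b')=(f\,(b\cdot f'),bb')$. $B$ embeds by $b\mapsto(\mathbf 1,b)$ with $\mathbf 1$ the constant function $e_A$, and $A$ embeds by $a\mapsto(\delta^a,e_B)$ with $\delta^a(e_B)=a$ and $\delta^a(x)=e_A$ for $x\ne e_B$. Here $B=H*K$ is the free product with generating set $S_H\cup S_K$, and $S_A\cup S_H\cup S_K$ is viewed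 inside $A\wr B$ via these embeddings. For a non-trivial finite group $G$ with generating set $S_G$, the Cayley graph $\mathrm{Cay}(G,S_G)$ has vertex set $G$ and edges joining $g$ to $gs$, $s\in S_G$. For $g\in G$, $\mathrm{TS}(e_G,g,G)$ is the minimal length of a path (vertices may be repeated) in $\mathrm{Cay}(G,S_G)$ which starts at $e_G$, ends at $g$ and visits all vertices of $G$. The Hamiltonian difference is $$\mathscr{H}(G,S_G)=\max_{g\in G\setminus\{e_G\}}\mathrm{TS}(e_G,g,G)-\mathrm{TS}(e_G,e_G,G).$$ *)

theory Defs
  imports
    "HOL-Algebra.Algebra"
    "HOL-Library.Extended_Nat"
    "Graph_Theory.Graph_Theory"
begin

section \<open>Word length and dead ends\<close>

definition fin_sym_generating :: "('a, 'm) monoid_scheme \<Rightarrow> 'a set \<Rightarrow> bool" where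
  "fin_sym_generating G S \<longleftrightarrow>
     finite S \<and> S \<subseteq> carrier G \<and> (\<forall>s\<in>S. inv\<^bsub>G\<^esub> s \<in> S) \<and> generate G S = carrier G"

definition word_prod :: "('a, 'm) monoid_scheme \<Rightarrow> 'a list \<Rightarrow> 'a" where
  "word_prod G ws = foldr (\<otimes>\<^bsub>G\<^esub>) ws \<one>\<^bsub>G\<^esub>"

text \<open>Words use letters of \<open>S\<close> only, without inverses; \<open>S\<close> is meant to be symmetric.\<close>

definition word_length :: "('a, 'm) monoid_scheme \<Rightarrow> 'a set \<Rightarrow> 'a \<Rightarrow> nat" where
  "word_length G S g = (LEAST n. \<exists>ws. set ws \<subseteq> S \<and> length ws = n \<and> word_prod G ws = g)"

definition dead_end :: "('a, 'm) monoid_scheme \<Rightarrow> 'a set \<Rightarrow> 'a \<Rightarrow> bool" where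
  "dead_end G S g \<longleftrightarrow>
     g \<in> carrier G \<and> (\<forall>s\<in>S. word_length G S (g \<otimes>\<^bsub>G\<^esub> s) \<le> word_length G S g)"

text \<open>
  For a dead end the set below contains 1, so the supremum is its maximum if there
  is one, and \<open>\<infinity>\<close> otherwise.
\<close>

definition depth :: "('a, 'm) monoid_scheme \<Rightarrow> 'a set \<Rightarrow> 'a \<Rightarrow> enat" where
  "depth G S g = Sup {enat n | n. 1 \<le> n \<and>
     (\<forall>ws. set ws \<subseteq> S \<and> length ws \<le> n \<longrightarrow>
        word_length G S (g \<otimes>\<^bsub>G\<^esub> word_prod G ws) \<le> word_length G S g)}"

definition unbounded_depth :: "('a, 'm) monoid_scheme \<Rightarrow> 'a set \<Rightarrow> bool" where
  "unbounded_depth G S \<longleftrightarrow> (\<forall>n::nat. \<exists>g. dead_end G S g \<and> enat n \<le> depth G S g)"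

definition uniformly_bounded_depth :: "('a, 'm) monoid_scheme \<Rightarrow> 'a set \<Rightarrow> bool" where
  "uniformly_bounded_depth G S \<longleftrightarrow> \<not> unbounded_depth G S"


section \<open>Free product of two groups\<close>

text \<open>
  Elements are the reduced words: sequences of non-trivial elements taken alternately
  from the two factors.
\<close>

definition reduced_words ::
  "('h, 'm) monoid_scheme \<Rightarrow> ('k, 'n) monoid_scheme \<Rightarrow> ('h + 'k) list set" where
  "reduced_words H K =
     {w. set w \<subseteq> (carrier H - {\<one>\<^bsub>H\<^esub>}) <+> (carrier K - {\<one>\<^bsub>K\<^esub>}) \<and>
         successively (\<lambda>x y. isl x \<noteq> isl y) w}"

text \<open>Left multiplication of a reduced word by a single non-trivial letter.\<close>

fun letter_mult ::
  "('h, 'm) monoid_scheme \<Rightarrow> ('k, 'n) monoid_scheme \<Rightarrow> 'h + 'k \<Rightarrow> ('h + 'k) list \<Rightarrow> ('h + 'k) list"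
where
  "letter_mult H K (Inl h) (Inl h' # w) =
     (if h \<otimes>\<^bsub>H\<^esub> h' = \<one>\<^bsub>H\<^esub> then w else Inl (h \<otimes>\<^bsub>H\<^esub> h') # w)"
| "letter_mult H K (Inr k) (Inr k' # w) =
     (if k \<otimes>\<^bsub>K\<^esub> k' = \<one>\<^bsub>K\<^esub> then w else Inr (k \<otimes>\<^bsub>K\<^esub> k') # w)"
| "letter_mult H K x w = x # w"

definition free_product ::
  "('h, 'm) monoid_scheme \<Rightarrow> ('k, 'n) monoid_scheme \<Rightarrow> ('h + 'k) list monoid" where
  "free_product H K =
     \<lparr>carrier = reduced_words H K, monoid.mult = foldr (letter_mult H K), one = []\<rparr>"

definition free_inl :: "('h, 'm) monoid_scheme \<Rightarrow> 'h \<Rightarrow> ('h + 'k) list" where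
  "free_inl H h = (if h = \<one>\<^bsub>H\<^esub> then [] else [Inl h])"

definition free_inr :: "('k, 'n) monoid_scheme \<Rightarrow> 'k \<Rightarrow> ('h + 'k) list" where
  "free_inr K k = (if k = \<one>\<^bsub>K\<^esub> then [] else [Inr k])"


section \<open>Wreath product\<close>

definition shift :: "('b, 'n) monoid_scheme \<Rightarrow> 'b \<Rightarrow> ('b \<Rightarrow> 'a) \<Rightarrow> 'b \<Rightarrow> 'a" where
  "shift B b f = (\<lambda>x\<in>carrier B. f (inv\<^bsub>B\<^esub> b \<otimes>\<^bsub>B\<^esub> x))"

abbreviation lamp_group ::
  "('a, 'm) monoid_scheme \<Rightarrow> ('b, 'n) monoid_scheme \<Rightarrow> ('b \<Rightarrow> 'a) monoid" where
  "lamp_group A B \<equiv> sum_group (carrier B) (\<lambda>_. A)"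

definition wreath_product ::
  "('a, 'm) monoid_scheme \<Rightarrow> ('b, 'n) monoid_scheme \<Rightarrow> (('b \<Rightarrow> 'a) \<times> 'b) monoid" where
  "wreath_product A B =
     \<lparr>carrier = carrier (lamp_group A B) \<times> carrier B,
      monoid.mult = (\<lambda>(f, b) (f', b'). (f \<otimes>\<^bsub>lamp_group A B\<^esub> shift B b f', b \<otimes>\<^bsub>B\<^esub> b')),
      one = (\<one>\<^bsub>lamp_group A B\<^esub>, \<one>\<^bsub>B\<^esub>)\<rparr>"

definition wreath_lamp ::
  "('a, 'm) monoid_scheme \<Rightarrow> ('b, 'n) monoid_scheme \<Rightarrow> 'a \<Rightarrow> ('b \<Rightarrow> 'a) \<times> 'b" where
  "wreath_lamp A B a = ((\<lambda>x\<in>carrier B. if x = \<one>\<^bsub>B\<^esub> then a else \<one>\<^bsub>A\<^esub>), \<one>\<^bsub>B\<^esub>)"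

definition wreath_base ::
  "('a, 'm) monoid_scheme \<Rightarrow> ('b, 'n) monoid_scheme \<Rightarrow> 'b \<Rightarrow> ('b \<Rightarrow> 'a) \<times> 'b" where
  "wreath_base A B b = (\<one>\<^bsub>lamp_group A B\<^esub>, b)"

text \<open>The set \<open>S\<^sub>A \<union> S\<^sub>H \<union> S\<^sub>K\<close> viewed inside the wreath product of \<open>A\<close> by \<open>H * K\<close>.\<close>

definition wreath_gens ::
  "('a, 'm) monoid_scheme \<Rightarrow> ('h, 'n) monoid_scheme \<Rightarrow> ('k, 'p) monoid_scheme \<Rightarrow>
   'a set \<Rightarrow> 'h set \<Rightarrow> 'k set \<Rightarrow> ((('h + 'k) list \<Rightarrow> 'a) \<times> ('h + 'k) list) set" where
  "wreath_gens A H K S\<^sub>A S\<^sub>H S\<^sub>K =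
     (let B = free_product H K in
        wreath_lamp A B ` S\<^sub>A \<union> wreath_base A B ` free_inl H ` S\<^sub>H
          \<union> wreath_base A B ` free_inr K ` S\<^sub>K)"


section \<open>Hamiltonian difference\<close>

text \<open>The undirected Cayley graph, as a digraph with arcs in both directions.\<close>

definition cayley_graph :: "('a, 'm) monoid_scheme \<Rightarrow> 'a set \<Rightarrow> 'a pair_pre_digraph" where
  "cayley_graph G S =
     \<lparr>pverts = carrier G,
      parcs = {(g, h). g \<in> carrier G \<and> h \<in> carrier G \<and>
                 (\<exists>s\<in>S. h = g \<otimes>\<^bsub>G\<^esub> s \<or> g = h \<otimes>\<^bsub>G\<^esub> s)}\<rparr>"

text \<open>Least length of a walk from \<open>g\<close> to \<open>h\<close> through all vertices (vertices may repeat).\<close>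

definition TS :: "('a, 'm) monoid_scheme \<Rightarrow> 'a set \<Rightarrow> 'a \<Rightarrow> 'a \<Rightarrow> nat" where
  "TS G S g h = (LEAST n. \<exists>p. vwalk p (with_proj (cayley_graph G S)) \<and>
     hd p = g \<and> last p = h \<and> set p = carrier G \<and> vwalk_length p = n)"

definition hamiltonian_difference :: "('a, 'm) monoid_scheme \<Rightarrow> 'a set \<Rightarrow> int" where
  "hamiltonian_difference G S =
     int (Max (TS G S \<one>\<^bsub>G\<^esub> ` (carrier G - {\<one>\<^bsub>G\<^esub>}))) - int (TS G S \<one>\<^bsub>G\<^esub> \<one>\<^bsub>G\<^esub>)"

end

theory Submission
  imports Defs
begin

text \<open>
  The length of \<open>(f, b)\<close> is the sum of the lengths of the lamps \<open>f x\<close> plus the least length of a tour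
  from the identity to \<open>b\<close> through the support of \<open>f\<close>. Hence, as \<open>A\<close> has unbounded depth, so does the
  wreath product iff for every \<open>n\<close> there are a finite set \<open>F\<close> and \<open>b\<close> with the \<open>n\<close>-ball around \<open>b\<close> in
  \<open>F\<close> such that moving the end point \<open>b\<close> of a tour through \<open>F\<close> within that ball never costs more.

  If \<open>F\<close> contains a whole coset \<open>C\<close> of \<open>H\<close> which tours enter at \<open>w\<close>, a tour ending at \<open>w x \<in> C\<close> consists of
  a walk in \<open>C\<close> through all of \<open>C\<close> and of excursions out of \<open>C\<close>, which can be rearranged along any other
  covering walk. So replacing the end point \<open>w x\<close> by \<open>w y\<close> changes the cost by the difference of the
  two values of TS. The same holds for \<open>K\<close>. Appending the letters that maximise TS in \<open>H\<close> and in \<open>K\<close> to \<open>b\<close>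
  costs at least the sum of the Hamiltonian differences, so \<open>b\<close> is not deep if that sum is positive.
  Otherwise, for \<open>F\<close> a ball, the costs along a reduced word change by at most alternately the two
  differences, and are maximal at the identity or at a single letter.
\<close>

section \<open>Words and tours\<close>

primrec visits :: "('a, 'm) monoid_scheme \<Rightarrow> 'a \<Rightarrow> 'a list \<Rightarrow> 'a set" where
  "visits G u [] = {u}"
| "visits G u (s # ws) = insert u (visits G (u \<otimes>\<^bsub>G\<^esub> s) ws)"

text \<open>Stated for words instead of walks, so that tours can be cut and reassembled letter by
  letter. For \<open>F\<close> the whole group this is the value of \<open>TS\<close> from the
  identity, see \<open>TS_eq_tour\<close>.\<close>

definition tour :: "('a, 'm) monoid_scheme \<Rightarrow> 'a set \<Rightarrow> 'a set \<Rightarrow> 'a \<Rightarrow> nat" where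
  "tour G S F g = (LEAST n. \<exists>ws. set ws \<subseteq> S \<and> length ws = n \<and> word_prod G ws = g \<and>
     F \<subseteq> visits G \<one>\<^bsub>G\<^esub> ws)"

lemma word_prod_simps [simp]:
  "word_prod G [] = \<one>\<^bsub>G\<^esub>"
  "word_prod G (s # ws) = s \<otimes>\<^bsub>G\<^esub> word_prod G ws"
  by (simp_all add: word_prod_def)

lemma start_in_visits [simp]: "u \<in> visits G u ws"
  by (cases ws) auto

context group
begin

lemma word_prod_closed [simp]: "set ws \<subseteq> carrier G \<Longrightarrow> word_prod G ws \<in> carrier G"
  by (induction ws) auto

lemma word_prod_append:
  "set us \<subseteq> carrier G \<Longrightarrow> set vs \<subseteq> carrier G \<Longrightarrow>
   word_prod G (us @ vs) = word_prod G us \<otimes> word_prod G vs"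
  by (induction us) (auto simp: m_assoc)

lemma visits_closed:
  "u \<in> carrier G \<Longrightarrow> set ws \<subseteq> carrier G \<Longrightarrow> visits G u ws \<subseteq> carrier G"
  by (induction ws arbitrary: u) auto

lemma end_in_visits:
  "u \<in> carrier G \<Longrightarrow> set ws \<subseteq> carrier G \<Longrightarrow> u \<otimes> word_prod G ws \<in> visits G u ws"
  by (induction ws arbitrary: u) (auto simp: m_assoc[symmetric])

lemma visits_append:
  "u \<in> carrier G \<Longrightarrow> set us \<subseteq> carrier G \<Longrightarrow> set vs \<subseteq> carrier G \<Longrightarrow>
   visits G u (us @ vs) = visits G u us \<union> visits G (u \<otimes> word_prod G us) vs"
  by (induction us arbitrary: u) (auto simp: m_assoc[symmetric])

lemma visits_translate:
  "a \<in> carrier G \<Longrightarrow> u \<in> carrier G \<Longrightarrow> set ws \<subseteq> carrier G \<Longrightarrow>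
   visits G (a \<otimes> u) ws = (\<otimes>) a ` visits G u ws"
  by (induction ws arbitrary: u) (auto simp: m_assoc)

end

locale generated_group = group G for G (structure) +
  fixes S
  assumes fsg: "fin_sym_generating G S"
begin

lemma finite_gens: "finite S"
  and gens_closed: "S \<subseteq> carrier G"
  and gens_inv: "s \<in> S \<Longrightarrow> inv s \<in> S"
  and generate_gens: "generate G S = carrier G"
  using fsg by (auto simp: fin_sym_generating_def)

lemma gen_closed [simp, intro]: "s \<in> S \<Longrightarrow> s \<in> carrier G"
  using gens_closed by blast

lemma word_closed [simp, intro]: "set ws \<subseteq> S \<Longrightarrow> set ws \<subseteq> carrier G"
  using gens_closed by blast

text \<open>The \<open>inv\<close> case of \<open>generate\<close> is a single letter since
  \<open>S\<close> is symmetric, so words without inverses suffice.\<close>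

lemma ex_word:
  assumes "g \<in> carrier G"
  shows "\<exists>ws. set ws \<subseteq> S \<and> word_prod G ws = g"
proof -
  have "g \<in> generate G S"
    using assms generate_gens by simp
  then show ?thesis
  proof induction
    case one
    show ?case by (intro exI[of _ "[]"]) simp
  next
    case (incl h)
    then show ?case by (intro exI[of _ "[h]"]) auto
  next
    case (inv h)
    then show ?case by (intro exI[of _ "[inv h]"]) (auto simp: gens_inv)
  next
    case (eng h1 h2)
    then obtain us vs where "set us \<subseteq> S" "word_prod G us = h1" "set vs \<subseteq> S" "word_prod G vs = h2"
      by blast
    then show ?case
      by (intro exI[of _ "us @ vs"]) (simp add: word_prod_append)
  qed
qed

lemma word_length_witness:
  assumes "g \<in> carrier G"
  obtains ws where "set ws \<subseteq> S" "length ws = word_length G S g" "word_prod G ws = g"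
proof -
  have "\<exists>n ws. set ws \<subseteq> S \<and> length ws = n \<and> word_prod G ws = g"
    using ex_word[OF assms] by blast
  from LeastI_ex[OF this] that show ?thesis
    unfolding word_length_def by blast
qed

lemma word_length_le: "set ws \<subseteq> S \<Longrightarrow> word_length G S (word_prod G ws) \<le> length ws"
  unfolding word_length_def by (rule Least_le) blast

lemma word_length_one [simp]: "word_length G S \<one> = 0"
  using word_length_le[of "[]"] by simp

lemma word_length_eq_0: "g \<in> carrier G \<Longrightarrow> word_length G S g = 0 \<Longrightarrow> g = \<one>"
  by (rule word_length_witness[of g]) auto

lemma word_length_gen_mult:
  assumes "s \<in> S" "g \<in> carrier G"
  shows "word_length G S (s \<otimes> g) \<le> Suc (word_length G S g)"
proof -
  obtain ws where "set ws \<subseteq> S" "length ws = word_length G S g" "word_prod G ws = g"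
    using word_length_witness[OF assms(2)] by blast
  then show ?thesis
    using word_length_le[of "s # ws"] assms by auto
qed

lemma ex_nontrivial_gen:
  assumes "carrier G \<noteq> {\<one>}"
  shows "\<exists>s\<in>S. s \<noteq> \<one>"
proof (rule ccontr)
  assume "\<not> ?thesis"
  then have "word_prod G ws = \<one>" if "set ws \<subseteq> S" for ws
    using that by (induction ws) auto
  then have "carrier G \<subseteq> {\<one>}"
    using ex_word by blast
  then show False
    using assms one_closed by blast
qed

text \<open>Visit the points of \<open>F\<close> one after the other. Hence the \<open>LEAST\<close>
  in \<open>tour\<close> is taken over a nonempty set and \<open>tour_witness\<close> can extract an
  optimal word.\<close>

lemma ex_tour:
  assumes "finite F" "F \<subseteq> carrier G" "g \<in> carrier G"
  shows "\<exists>ws. set ws \<subseteq> S \<and> word_prod G ws = g \<and> F \<subseteq> visits G \<one> ws"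
  using assms
proof (induction F arbitrary: g rule: finite_induct)
  case empty
  then show ?case using ex_word by auto
next
  case (insert x F)
  then obtain us where us: "set us \<subseteq> S" "word_prod G us = x" "F \<subseteq> visits G \<one> us"
    by (metis insert_subset)
  \<comment> \<open>After covering \<open>F\<close> with end point \<open>x\<close>, which counts as
    visited, \<open>vs\<close> leads on to the prescribed end.\<close>
  obtain vs where vs: "set vs \<subseteq> S" "word_prod G vs = inv x \<otimes> g"
    using ex_word[of "inv x \<otimes> g"] insert.prems by auto
  have "x \<otimes> (inv x \<otimes> g) = g"
    using insert.prems by (simp add: m_assoc[symmetric])
  then have "word_prod G (us @ vs) = g"
    using us vs by (simp add: word_prod_append)
  moreover have "visits G \<one> (us @ vs) = visits G \<one> us \<union> visits G x vs"
    using us vs insert.prems by (simp add: visits_append)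
  ultimately show ?case
    using us vs by (intro exI[of _ "us @ vs"]) auto
qed

lemma tour_witness:
  assumes "finite F" "F \<subseteq> carrier G" "g \<in> carrier G"
  obtains ws where "set ws \<subseteq> S" "length ws = tour G S F g" "word_prod G ws = g"
    "F \<subseteq> visits G \<one> ws"
proof -
  have "\<exists>n ws. set ws \<subseteq> S \<and> length ws = n \<and> word_prod G ws = g \<and> F \<subseteq> visits G \<one> ws"
    using ex_tour[OF assms] by blast
  from LeastI_ex[OF this] that show ?thesis
    unfolding tour_def by blast
qed

lemma tour_le:
  "set ws \<subseteq> S \<Longrightarrow> word_prod G ws = g \<Longrightarrow> F \<subseteq> visits G \<one> ws \<Longrightarrow> tour G S F g \<le> length ws"
  unfolding tour_def by (rule Least_le) blast

lemma tour_mono: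
  assumes "F \<subseteq> F'" "finite F'" "F' \<subseteq> carrier G" "g \<in> carrier G"
  shows "tour G S F g \<le> tour G S F' g"
  by (rule tour_witness[OF assms(2-4)]) (metis assms(1) subset_trans tour_le)

section \<open>Walks in the Cayley graph as words\<close>

lemma word_imp_vwalk:
  assumes "u \<in> carrier G" "set ws \<subseteq> S"
  shows "\<exists>p. vwalk p (with_proj (cayley_graph G S)) \<and> hd p = u \<and>
    last p = u \<otimes> word_prod G ws \<and> set p = visits G u ws \<and> length p = Suc (length ws)"
  using assms
proof (induction ws arbitrary: u)
  case Nil
  then show ?case
    by (intro exI[of _ "[u]"]) (auto simp: vwalk_def cayley_graph_def)
next
  case (Cons s ws)
  then obtain p where p: "vwalk p (with_proj (cayley_graph G S))" "hd p = u \<otimes> s"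
    "last p = u \<otimes> s \<otimes> word_prod G ws" "set p = visits G (u \<otimes> s) ws" "length p = Suc (length ws)"
    by (metis gen_closed insert_subset list.simps(15) m_closed)
  have "vwalk (u # p) (with_proj (cayley_graph G S))"
    using p Cons.prems by (auto simp: vwalk_def vwalk_arcs_Cons cayley_graph_def)
  then show ?case
    using p Cons.prems by (intro exI[of _ "u # p"]) (auto simp: vwalk_def m_assoc)
qed

text \<open>The graph has arcs in both directions; an arc running against its generator is read as
  the inverse letter. A walk lists vertices, hence one entry more than there are letters.\<close>

lemma vwalk_imp_word:
  assumes "vwalk p (with_proj (cayley_graph G S))"
  shows "\<exists>ws. set ws \<subseteq> S \<and> last p = hd p \<otimes> word_prod G ws \<and>
    set p = visits G (hd p) ws \<and> length p = Suc (length ws)"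
  using assms
proof (induction p rule: list.induct)
  case Nil
  then show ?case by (simp add: vwalk_def)
next
  case (Cons x p)
  show ?case
  proof (cases p)
    case Nil
    then show ?thesis
      using Cons.prems by (intro exI[of _ "[]"]) (auto simp: vwalk_def cayley_graph_def)
  next
    case (Cons y q)
    have "vwalk p (with_proj (cayley_graph G S))" and arc: "(x, y) \<in> parcs (cayley_graph G S)"
      using \<open>vwalk (x # p) _\<close> Cons by (auto simp: vwalk_def)
    with Cons.IH obtain ws where ws: "set ws \<subseteq> S" "last p = hd p \<otimes> word_prod G ws"
      "set p = visits G (hd p) ws" "length p = Suc (length ws)"
      by blast
    have xy: "x \<in> carrier G" "y \<in> carrier G"
      using arc by (auto simp: cayley_graph_def)
    obtain s where s: "s \<in> S" "y = x \<otimes> s \<or> x = y \<otimes> s"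
      using arc by (auto simp: cayley_graph_def)
    have "x = y \<otimes> s \<Longrightarrow> y = x \<otimes> inv s"
      using s(1) xy by (simp add: m_assoc)
    with s gens_inv obtain t where t: "t \<in> S" "y = x \<otimes> t"
      by blast
    show ?thesis
      using Cons ws t xy by (intro exI[of _ "t # ws"]) (auto simp: m_assoc)
  qed
qed

text \<open>The predicates under the two \<open>LEAST\<close>s agree for every length: a word never
  leaves \<open>carrier G\<close>, so covering the carrier is the same as having it as the set of
  vertices.\<close>

lemma TS_eq_tour: "TS G S \<one> g = tour G S (carrier G) g"
proof -
  have "(\<exists>p. vwalk p (with_proj (cayley_graph G S)) \<and> hd p = \<one> \<and> last p = g \<and>
           set p = carrier G \<and> vwalk_length p = n) \<longleftrightarrow>
        (\<exists>ws. set ws \<subseteq> S \<and> length ws = n \<and> word_prod G ws = g \<and> carrier G \<subseteq> visits G \<one> ws)"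
    (is "?L \<longleftrightarrow> ?R") for n
  proof
    assume ?L
    then obtain p where p: "vwalk p (with_proj (cayley_graph G S))" "hd p = \<one>" "last p = g"
      "set p = carrier G" "vwalk_length p = n"
      by blast
    with vwalk_imp_word[OF p(1)] show ?R
      by (metis diff_Suc_1 gens_closed l_one order_refl subset_trans vwalk_length_simp
          word_prod_closed)
  next
    assume ?R
    then obtain ws where ws: "set ws \<subseteq> S" "length ws = n" "word_prod G ws = g"
      "carrier G \<subseteq> visits G \<one> ws"
      by blast
    have "visits G \<one> ws = carrier G"
      using ws visits_closed[of \<one> ws] by auto
    with word_imp_vwalk[OF one_closed ws(1)] ws show ?L
      by (metis diff_Suc_1 gens_closed l_one order_refl subset_trans vwalk_length_simp
          word_prod_closed)
  qed
  then show ?thesis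
    by (simp add: TS_def tour_def)
qed

end

section \<open>Rearranging a tour inside a coset of a factor\<close>

text \<open>
  \<open>proj\<close> is the nearest-point projection onto the copy \<open>C\<close> of the factor: it is unaffected by a
  move unless that move is an edge of \<open>C\<close>.
\<close>

locale free_factor = B: generated_group B M + G: generated_group G S
  for B (structure) and M and G (structure) and S +
  fixes emb and proj
  assumes emb_hom: "emb \<in> hom G B"
    and emb_inj: "inj_on emb (carrier G)"
    and emb_gens: "emb ` S \<subseteq> M"
    and proj_in: "b \<in> carrier B \<Longrightarrow> proj b \<in> emb ` carrier G"
    and proj_emb: "b \<in> emb ` carrier G \<Longrightarrow> proj b = b"
    and proj_mult: "b \<in> carrier B \<Longrightarrow> m \<in> M \<Longrightarrow> \<not> (b \<in> emb ` carrier G \<and> m \<in> emb ` S) \<Longrightarrow>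
      proj (b \<otimes>\<^bsub>B\<^esub> m) = proj b"
    and finite_factor: "finite (carrier G)"
begin

definition C where "C = emb ` carrier G"

lemmas proj_in_C = proj_in[folded C_def]
lemmas proj_C = proj_emb[folded C_def]
lemmas proj_move = proj_mult[folded C_def]

lemma emb_C [simp]: "x \<in> carrier G \<Longrightarrow> emb x \<in> C"
  by (simp add: C_def)

lemma finite_C: "finite C"
  using finite_factor by (simp add: C_def)

lemma emb_closed [simp]: "x \<in> carrier G \<Longrightarrow> emb x \<in> carrier B"
  using emb_hom by (auto simp: hom_def)

lemma emb_mult: "x \<in> carrier G \<Longrightarrow> y \<in> carrier G \<Longrightarrow> emb (x \<otimes>\<^bsub>G\<^esub> y) = emb x \<otimes>\<^bsub>B\<^esub> emb y"
  using emb_hom by (auto simp: hom_def)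

lemma emb_one [simp]: "emb \<one>\<^bsub>G\<^esub> = \<one>\<^bsub>B\<^esub>"
  using hom_one[OF emb_hom] G.is_group B.is_group by simp

lemma C_closed [simp]: "x \<in> C \<Longrightarrow> x \<in> carrier B"
  by (auto simp: C_def)

lemma C_mult: "x \<in> C \<Longrightarrow> y \<in> C \<Longrightarrow> x \<otimes>\<^bsub>B\<^esub> y \<in> C"
  by (auto simp: C_def emb_mult[symmetric])

lemma gens_C: "s \<in> emb ` S \<Longrightarrow> s \<in> C"
  by auto

lemma word_prod_emb:
  "set ws \<subseteq> carrier G \<Longrightarrow> word_prod B (map emb ws) = emb (word_prod G ws)"
  by (induction ws) (auto simp: emb_mult)

lemma visits_emb:
  "u \<in> carrier G \<Longrightarrow> set ws \<subseteq> carrier G \<Longrightarrow> visits B (emb u) (map emb ws) = emb ` visits G u ws"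
  by (induction ws arbitrary: u) (auto simp: emb_mult[symmetric])

lemma visits_C: "c \<in> C \<Longrightarrow> set q \<subseteq> emb ` S \<Longrightarrow> visits B c q \<subseteq> C"
proof (induction q arbitrary: c)
  case (Cons s q)
  then have "visits B (c \<otimes>\<^bsub>B\<^esub> s) q \<subseteq> C"
    by (intro Cons.IH C_mult[OF _ gens_C]) simp_all
  then show ?case
    using Cons.prems by simp
qed simp

text \<open>
  The word \<open>E x\<close> collects the excursions of a word at \<open>x \<in> C\<close>. They are closed loops at \<open>x\<close>,
  except that the first excursion starts at \<open>u\<close> and leads to \<open>c = proj u\<close>.
\<close>

definition excursions where
  "excursions u c E \<longleftrightarrow> (\<forall>x\<in>C. set (E x) \<subseteq> M \<and>
     (if x = c then u else x) \<otimes>\<^bsub>B\<^esub> word_prod B (E x) = x)"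

definition excursion_visits where
  "excursion_visits u c E x = visits B (if x = c then u else x) (E x)"

lemma excursions_start:
  assumes "excursions u c E" "c \<in> C"
  shows "set (E c) \<subseteq> M" "u \<otimes>\<^bsub>B\<^esub> word_prod B (E c) = c"
  using bspec[OF assms(1)[unfolded excursions_def] assms(2)] by simp_all

lemma excursions_loop:
  assumes "excursions u c E" "x \<in> C" "x \<noteq> c"
  shows "set (E x) \<subseteq> M" "x \<otimes>\<^bsub>B\<^esub> word_prod B (E x) = x"
  using bspec[OF assms(1)[unfolded excursions_def] assms(2)] assms(3) by simp_all

text \<open>Used for a move that does not change \<open>proj\<close>: prepending it to the first
  excursion moves the start back from \<open>u m\<close> to \<open>u\<close> and keeps the point
  \<open>c\<close> where that excursion ends.\<close>

lemma excursions_push: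
  assumes E: "excursions (u \<otimes>\<^bsub>B\<^esub> m) c E" and u: "u \<in> carrier B" and m: "m \<in> M"
  shows "excursions u c (E(c := m # E c))"
proof -
  have "set ((E(c := m # E c)) x) \<subseteq> M \<and>
      (if x = c then u else x) \<otimes>\<^bsub>B\<^esub> word_prod B ((E(c := m # E c)) x) = x" if "x \<in> C" for x
  proof (cases "x = c")
    case True
    then show ?thesis
      using excursions_start[OF E] that u m by (simp add: B.m_assoc[symmetric])
  next
    case False
    then show ?thesis
      using excursions_loop[OF E that] by simp
  qed
  then show ?thesis
    by (simp add: excursions_def)
qed

text \<open>Stated additively, since subtraction of lengths would truncate.\<close>

lemma sum_push:
  assumes "finite T" "c \<in> T"
  shows "(\<Sum>x\<in>T. length ((E(c := ws)) x)) + length (E c) = (\<Sum>x\<in>T. length (E x)) + length ws"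
  using sum.remove[OF assms, of "\<lambda>x. length ((E(c := ws)) x)"]
    sum.remove[OF assms, of "\<lambda>x. length (E x)"] by simp

text \<open>The word is processed from its end. An edge of \<open>C\<close> becomes a letter of
  \<open>q\<close>; any other letter keeps \<open>proj\<close> fixed and joins the excursion at the
  current projection. All excursions from one point of \<open>C\<close> are merged into one word,
  hence the sum over \<open>C\<close>. As the end point lies in \<open>C\<close>, every excursion
  closes up.\<close>

lemma decompose:
  assumes "set ws \<subseteq> M" "u \<in> carrier B" "u \<otimes>\<^bsub>B\<^esub> word_prod B ws \<in> C"
  shows "\<exists>E q. excursions u (proj u) E \<and> set q \<subseteq> emb ` S \<and>
    proj u \<otimes>\<^bsub>B\<^esub> word_prod B q = u \<otimes>\<^bsub>B\<^esub> word_prod B ws \<and>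
    C \<inter> visits B u ws \<subseteq> visits B (proj u) q \<and>
    visits B u ws \<subseteq> (\<Union>x\<in>visits B (proj u) q. excursion_visits u (proj u) E x) \<and>
    length ws = length q + (\<Sum>x\<in>C. length (E x))"
  using assms
proof (induction ws arbitrary: u)
  case Nil
  then have "u \<in> C" "proj u = u"
    using proj_C by simp_all
  then show ?case
    using Nil
    by (intro exI[of _ "\<lambda>_. []"] exI[of _ "[]"])
      (auto simp: excursions_def excursion_visits_def)
next
  case (Cons m ws)
  define c where "c = proj u"
  have m: "m \<in> M" "m \<in> carrier B" and ws: "set ws \<subseteq> M" and u: "u \<in> carrier B"
    using Cons.prems by auto
  have c: "c \<in> C"
    using proj_in_C[OF u] by (simp add: c_def)
  have um: "u \<otimes>\<^bsub>B\<^esub> m \<in> carrier B"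
    using m u by simp
  have "u \<otimes>\<^bsub>B\<^esub> m \<otimes>\<^bsub>B\<^esub> word_prod B ws = u \<otimes>\<^bsub>B\<^esub> word_prod B (m # ws)"
    using m u ws by (simp add: B.m_assoc)
  with Cons.IH[OF ws um] Cons.prems(3) obtain E q where
    E: "excursions (u \<otimes>\<^bsub>B\<^esub> m) (proj (u \<otimes>\<^bsub>B\<^esub> m)) E" and
    q: "set q \<subseteq> emb ` S"
      "proj (u \<otimes>\<^bsub>B\<^esub> m) \<otimes>\<^bsub>B\<^esub> word_prod B q = u \<otimes>\<^bsub>B\<^esub> word_prod B (m # ws)"
      "C \<inter> visits B (u \<otimes>\<^bsub>B\<^esub> m) ws \<subseteq> visits B (proj (u \<otimes>\<^bsub>B\<^esub> m)) q" and
    cov: "visits B (u \<otimes>\<^bsub>B\<^esub> m) ws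
      \<subseteq> (\<Union>x\<in>visits B (proj (u \<otimes>\<^bsub>B\<^esub> m)) q. excursion_visits (u \<otimes>\<^bsub>B\<^esub> m) (proj (u \<otimes>\<^bsub>B\<^esub> m)) E x)" and
    len: "length ws = length q + (\<Sum>x\<in>C. length (E x))"
    by auto
  show ?case
  proof (cases "u \<in> C \<and> m \<in> emb ` S")
    case True
    \<comment> \<open>Here all excursions are closed loops, both before and after the edge, so
      \<open>E\<close> is kept and \<open>m\<close> goes to \<open>q\<close>.\<close>
    then have cu: "c = u" and uC: "u \<otimes>\<^bsub>B\<^esub> m \<in> C"
      using proj_C C_mult gens_C by (auto simp: c_def)
    then have p: "proj (u \<otimes>\<^bsub>B\<^esub> m) = u \<otimes>\<^bsub>B\<^esub> m"
      using proj_C by simp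
    have E': "excursions u c E"
      using E by (simp add: excursions_def cu p)
    have ev: "excursion_visits u c E x = excursion_visits (u \<otimes>\<^bsub>B\<^esub> m) (u \<otimes>\<^bsub>B\<^esub> m) E x" for x
      by (simp add: excursion_visits_def cu)
    have "set q \<subseteq> carrier B"
      using q(1) by auto
    then have "c \<otimes>\<^bsub>B\<^esub> word_prod B (m # q) = u \<otimes>\<^bsub>B\<^esub> word_prod B (m # ws)"
      using q(2) m u by (simp add: p cu B.m_assoc[symmetric])
    moreover have "visits B u (m # ws) \<subseteq> (\<Union>x\<in>visits B c (m # q). excursion_visits u c E x)"
      using cov by (auto simp: ev p cu excursion_visits_def)
    ultimately show ?thesis
      using E' q len True
      by (intro exI[of _ E] exI[of _ "m # q"]) (auto simp: c_def[symmetric] cu p)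
  next
    case False
    then have p: "proj (u \<otimes>\<^bsub>B\<^esub> m) = c"
      using proj_move u m by (auto simp: c_def)
    \<comment> \<open>The letter \<open>m\<close> opens the excursion at \<open>c\<close>, which
      then continues with \<open>E c\<close>.\<close>
    let ?E = "E(c := m # E c)"
    have E': "excursions u c ?E"
      using excursions_push E u m by (simp add: p)
    have ev: "excursion_visits (u \<otimes>\<^bsub>B\<^esub> m) c E x \<subseteq> excursion_visits u c ?E x" for x
      by (auto simp: excursion_visits_def)
    have u_ev: "u \<in> excursion_visits u c ?E c"
      by (simp add: excursion_visits_def)
    have "C \<inter> visits B u (m # ws) \<subseteq> visits B c q"
      using q(3) proj_C by (auto simp: p c_def)
    moreover have "visits B u (m # ws) \<subseteq> (\<Union>x\<in>visits B c q. excursion_visits u c ?E x)"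
      using cov ev u_ev by (fastforce simp: p)
    moreover have "length (m # ws) = length q + (\<Sum>x\<in>C. length (?E x))"
      using sum_push[of C c E "m # E c"] finite_C c len by simp
    ultimately show ?thesis
      using E' q by (intro exI[of _ ?E] exI[of _ q]) (simp add: c_def[symmetric] p del: fun_upd_apply)
  qed
qed

text \<open>Make the excursion at \<open>x\<close> when \<open>q\<close> first reaches
  \<open>x\<close>; it ends at \<open>x\<close>, so \<open>q\<close> can go on from there.
  Excursions at points that \<open>q\<close> never visits are dropped, hence only an inequality for
  the length.\<close>

lemma assemble:
  assumes "excursions u c E" "u \<in> carrier B" "c \<in> C" "set q \<subseteq> emb ` S"
  shows "\<exists>ws. set ws \<subseteq> M \<and> u \<otimes>\<^bsub>B\<^esub> word_prod B ws = c \<otimes>\<^bsub>B\<^esub> word_prod B q \<and>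
    (\<Union>x\<in>visits B c q. excursion_visits u c E x) \<subseteq> visits B u ws \<and>
    length ws \<le> length q + (\<Sum>x\<in>C. length (E x))"
  using assms
proof (induction q arbitrary: u c E)
  case Nil
  have "length (E c) \<le> (\<Sum>x\<in>C. length (E x))"
    using member_le_sum[of c C "\<lambda>x. length (E x)"] finite_C Nil by simp
  then show ?case
    using Nil excursions_start[OF Nil(1,3)]
    by (intro exI[of _ "E c"]) (auto simp: excursion_visits_def)
next
  case (Cons s q)
  \<comment> \<open>The excursion at \<open>c\<close> is made now, so it is emptied for later visits
    of \<open>c\<close>.\<close>
  let ?E = "E(c := [])" and ?d = "c \<otimes>\<^bsub>B\<^esub> s"
  have s: "s \<in> M" "s \<in> C" "s \<in> carrier B" and q: "set q \<subseteq> emb ` S" "set q \<subseteq> carrier B"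
    using Cons.prems(4) emb_gens by auto
  note Ec = excursions_start[OF Cons.prems(1,3)]
  have c: "c \<in> carrier B" and d: "?d \<in> C" "?d \<in> carrier B"
    using C_mult[OF Cons.prems(3) s(2)] Cons.prems(3) by auto
  have "excursions ?d ?d ?E"
    using Cons.prems(1) c by (auto simp: excursions_def)
  from Cons.IH[OF this d(2,1) q(1)] obtain ws where ws: "set ws \<subseteq> M"
    "?d \<otimes>\<^bsub>B\<^esub> word_prod B ws = ?d \<otimes>\<^bsub>B\<^esub> word_prod B q"
    "(\<Union>x\<in>visits B ?d q. excursion_visits ?d ?d ?E x) \<subseteq> visits B ?d ws"
    "length ws \<le> length q + (\<Sum>x\<in>C. length (?E x))"
    by blast
  let ?ws = "E c @ s # ws"
  have car: "set (E c) \<subseteq> carrier B" "set ws \<subseteq> carrier B"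
    using Ec ws by auto
  have "u \<otimes>\<^bsub>B\<^esub> word_prod B ?ws = c \<otimes>\<^bsub>B\<^esub> (s \<otimes>\<^bsub>B\<^esub> word_prod B ws)"
    using car s c Cons.prems(2)
    by (simp add: B.word_prod_append B.m_assoc[symmetric] Ec(2))
  also have "\<dots> = c \<otimes>\<^bsub>B\<^esub> word_prod B (s # q)"
    using ws(2) car q s c by (simp add: B.m_assoc)
  finally have "u \<otimes>\<^bsub>B\<^esub> word_prod B ?ws = c \<otimes>\<^bsub>B\<^esub> word_prod B (s # q)" .
  moreover have vis: "visits B u ?ws = visits B u (E c) \<union> insert c (visits B ?d ws)"
    using Ec(2) car s Cons.prems(2) by (simp add: B.visits_append)
  have "excursion_visits u c E x \<subseteq> visits B u ?ws" if "x \<in> visits B c (s # q)" for x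
  proof (cases "x = c")
    case True
    then show ?thesis by (auto simp: excursion_visits_def vis)
  next
    case False
    then have "excursion_visits u c E x = excursion_visits ?d ?d ?E x"
      by (simp add: excursion_visits_def)
    moreover have "x \<in> visits B ?d q"
      using that False by simp
    ultimately show ?thesis
      using ws(3) by (auto simp: vis)
  qed
  moreover have "length ?ws \<le> length (s # q) + (\<Sum>x\<in>C. length (E x))"
    using sum_push[of C c E "[]"] finite_C Cons.prems(3) ws(4) by simp
  ultimately show ?case
    using Ec s ws by (intro exI[of _ ?ws]) auto
qed

text \<open>Translate by the inverse of \<open>w\<close>, so that the coset becomes \<open>C\<close>
  and is entered at the identity. In an optimal tour to \<open>w x\<close>, the part
  \<open>q\<close> inside \<open>C\<close> has at least \<open>TS\<close> many letters, and an
  optimal covering walk \<open>r\<close> to \<open>y\<close> can take its place with the same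
  excursions. The form with sums avoids subtraction of natural numbers.\<close>

lemma tour_swap:
  assumes F: "finite F" "F \<subseteq> carrier B" and w: "w \<in> carrier B" "proj (inv\<^bsub>B\<^esub> w) = \<one>\<^bsub>B\<^esub>"
    and cov: "(\<otimes>\<^bsub>B\<^esub>) w ` C \<subseteq> F" and x: "x \<in> carrier G" and y: "y \<in> carrier G"
  shows "tour B M F (w \<otimes>\<^bsub>B\<^esub> emb y) + TS G S \<one>\<^bsub>G\<^esub> x \<le> tour B M F (w \<otimes>\<^bsub>B\<^esub> emb x) + TS G S \<one>\<^bsub>G\<^esub> y"
proof -
  define u where "u = inv\<^bsub>B\<^esub> w"
  have u: "u \<in> carrier B" "proj u = \<one>\<^bsub>B\<^esub>" and wu: "w \<otimes>\<^bsub>B\<^esub> u = \<one>\<^bsub>B\<^esub>"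
    using w by (auto simp: u_def)
  have uw: "u \<otimes>\<^bsub>B\<^esub> (w \<otimes>\<^bsub>B\<^esub> z) = z" if "z \<in> carrier B" for z
    using w that by (simp add: u_def B.m_assoc[symmetric])
  have wu': "w \<otimes>\<^bsub>B\<^esub> (u \<otimes>\<^bsub>B\<^esub> z) = z" if "z \<in> carrier B" for z
    using w u wu that by (simp add: B.m_assoc[symmetric])
  obtain ws where ws: "set ws \<subseteq> M" "length ws = tour B M F (w \<otimes>\<^bsub>B\<^esub> emb x)"
    "word_prod B ws = w \<otimes>\<^bsub>B\<^esub> emb x" "F \<subseteq> visits B \<one>\<^bsub>B\<^esub> ws"
    using B.tour_witness[OF F, of "w \<otimes>\<^bsub>B\<^esub> emb x"] w x by auto
  have vis: "visits B \<one>\<^bsub>B\<^esub> vs = (\<otimes>\<^bsub>B\<^esub>) w ` visits B u vs" if "set vs \<subseteq> M" for vs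
    using B.visits_translate[of w u vs] w u that by (simp add: wu B.word_closed)
  have end_x: "u \<otimes>\<^bsub>B\<^esub> word_prod B ws = emb x"
    using ws(3) x uw by simp
  have "u \<otimes>\<^bsub>B\<^esub> word_prod B ws \<in> C"
    using end_x x by simp
  from decompose[OF ws(1) u(1) this] obtain E q where
    E: "excursions u \<one>\<^bsub>B\<^esub> E" and
    q: "set q \<subseteq> emb ` S" "\<one>\<^bsub>B\<^esub> \<otimes>\<^bsub>B\<^esub> word_prod B q = emb x" "C \<inter> visits B u ws \<subseteq> visits B \<one>\<^bsub>B\<^esub> q" and
    cover: "visits B u ws \<subseteq> (\<Union>x\<in>visits B \<one>\<^bsub>B\<^esub> q. excursion_visits u \<one>\<^bsub>B\<^esub> E x)" and
    len: "length ws = length q + (\<Sum>x\<in>C. length (E x))"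
    by (auto simp: u end_x)
  have one_C: "\<one>\<^bsub>B\<^esub> \<in> C"
    using emb_C[of "\<one>\<^bsub>G\<^esub>"] by simp
  \<comment> \<open>The hypothesis on \<open>F\<close> forces the tour through the whole coset; this
    is why \<open>q\<close> covers \<open>C\<close>.\<close>
  have C_visited: "C \<subseteq> visits B u ws"
  proof
    fix z assume z: "z \<in> C"
    then have "w \<otimes>\<^bsub>B\<^esub> z \<in> (\<otimes>\<^bsub>B\<^esub>) w ` visits B u ws"
      using cov ws(4) vis[OF ws(1)] by blast
    then obtain z' where "z' \<in> visits B u ws" "w \<otimes>\<^bsub>B\<^esub> z = w \<otimes>\<^bsub>B\<^esub> z'"
      by blast
    moreover from this have "z' \<in> carrier B"
      using B.visits_closed[OF u(1)] ws(1) by blast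
    ultimately show "z \<in> visits B u ws"
      using z w by (metis B.l_cancel C_closed)
  qed
  obtain q0 where q0: "set q0 \<subseteq> S" "q = map emb q0"
    using q(1) by (metis imageE in_lists_conv_set lists_image subsetI subsetD)
  have "word_prod G q0 = x"
  proof -
    have "emb (word_prod G q0) = emb x"
      using q(2) q0 x by (simp add: word_prod_emb G.word_closed)
    then show ?thesis
      using emb_inj x q0 by (auto dest!: inj_onD simp: G.word_closed)
  qed
  moreover have "carrier G \<subseteq> visits G \<one>\<^bsub>G\<^esub> q0"
  proof
    fix z assume z: "z \<in> carrier G"
    then have "emb z \<in> visits B \<one>\<^bsub>B\<^esub> q"
      using q(3) C_visited emb_C by blast
    then have "emb z \<in> emb ` visits G \<one>\<^bsub>G\<^esub> q0"
      using visits_emb[of "\<one>\<^bsub>G\<^esub>" q0] q0 by (simp add: G.word_closed)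
    then show "z \<in> visits G \<one>\<^bsub>G\<^esub> q0"
      using emb_inj z G.visits_closed[of "\<one>\<^bsub>G\<^esub>" q0] q0
      by (auto dest!: inj_onD simp: G.word_closed)
  qed
  ultimately have TSx: "TS G S \<one>\<^bsub>G\<^esub> x \<le> length q"
    using G.tour_le[of q0] q0 by (simp add: G.TS_eq_tour)
  obtain r where r: "set r \<subseteq> S" "length r = TS G S \<one>\<^bsub>G\<^esub> y" "word_prod G r = y"
    "carrier G \<subseteq> visits G \<one>\<^bsub>G\<^esub> r"
    using G.tour_witness[OF finite_factor order_refl y] by (auto simp: G.TS_eq_tour)
  have r': "set (map emb r) \<subseteq> emb ` S" "word_prod B (map emb r) = emb y"
    "C \<subseteq> visits B \<one>\<^bsub>B\<^esub> (map emb r)"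
    using r visits_emb[of "\<one>\<^bsub>G\<^esub>" r] by (auto simp: C_def word_prod_emb G.word_closed)
  from assemble[OF E u(1) one_C r'(1)] obtain vs where vs: "set vs \<subseteq> M"
    "u \<otimes>\<^bsub>B\<^esub> word_prod B vs = emb y"
    "(\<Union>x\<in>visits B \<one>\<^bsub>B\<^esub> (map emb r). excursion_visits u \<one>\<^bsub>B\<^esub> E x) \<subseteq> visits B u vs"
    "length vs \<le> length r + (\<Sum>x\<in>C. length (E x))"
    using r'(2) y by auto
  \<comment> \<open>\<open>q\<close> never leaves \<open>C\<close> and \<open>r\<close> covers
    \<open>C\<close>, so each excursion made along \<open>q\<close> is also made along
    \<open>r\<close>.\<close>
  have "visits B \<one>\<^bsub>B\<^esub> q \<subseteq> visits B \<one>\<^bsub>B\<^esub> (map emb r)"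
    using visits_C[OF one_C q(1)] r'(3) by blast
  then have "visits B u ws \<subseteq> visits B u vs"
    using cover vs(3) by blast
  then have "F \<subseteq> visits B \<one>\<^bsub>B\<^esub> vs"
    using ws(4) vis[OF ws(1)] vis[OF vs(1)] by blast
  moreover have "word_prod B vs = w \<otimes>\<^bsub>B\<^esub> emb y"
    using vs(1,2) wu'[of "word_prod B vs"] by (simp add: B.word_closed)
  ultimately have "tour B M F (w \<otimes>\<^bsub>B\<^esub> emb y) \<le> length vs"
    using B.tour_le vs(1) by blast
  then show ?thesis
    using vs(4) len TSx ws(2) r(2) by simp
qed

end

section \<open>The free product\<close>

abbreviation letters ::
  "('h, 'm) monoid_scheme \<Rightarrow> ('k, 'n) monoid_scheme \<Rightarrow> ('h + 'k) set" where
  "letters H K \<equiv> (carrier H - {\<one>\<^bsub>H\<^esub>}) <+> (carrier K - {\<one>\<^bsub>K\<^esub>})"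

definition letter_inv ::
  "('h, 'm) monoid_scheme \<Rightarrow> ('k, 'n) monoid_scheme \<Rightarrow> 'h + 'k \<Rightarrow> 'h + 'k" where
  "letter_inv H K = map_sum (m_inv H) (m_inv K)"

text \<open>
  The nearest-point projection of the free product onto one of its factors, which is \<open>H\<close> for
  \<open>left = True\<close> and \<open>K\<close> for \<open>left = False\<close>.
\<close>

definition side_proj :: "bool \<Rightarrow> ('h + 'k) list \<Rightarrow> ('h + 'k) list" where
  "side_proj left w = (case w of [] \<Rightarrow> [] | x # _ \<Rightarrow> if isl x = left then [x] else [])"

lemma side_proj_simps [simp]:
  "side_proj left [] = []"
  "side_proj left (x # w) = (if isl x = left then [x] else [])"
  by (simp_all add: side_proj_def)

lemma isl_letter_inv [simp]: "isl (letter_inv H K x) = isl x"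
  by (cases x) (auto simp: letter_inv_def)

lemma carrier_free_product [simp]: "carrier (free_product H K) = reduced_words H K"
  and mult_free_product [simp]: "monoid.mult (free_product H K) = foldr (letter_mult H K)"
  and one_free_product [simp]: "\<one>\<^bsub>free_product H K\<^esub> = []"
  by (simp_all add: free_product_def)

lemma letter_mult_Nil [simp]: "letter_mult H K x [] = [x]"
  by (cases x) auto

lemma letter_mult_alternating: "isl x \<noteq> isl y \<Longrightarrow> letter_mult H K x (y # w) = x # y # w"
  by (cases x; cases y) auto

lemma letter_mult_same_side:
  "isl x = isl y \<Longrightarrow> letter_mult H K x (y # w) = w \<or>
    (\<exists>z. letter_mult H K x (y # w) = z # w \<and> isl z = isl x)"
  by (cases x; cases y) auto

lemma in_letters [simp]:
  "Inl h \<in> letters H K \<longleftrightarrow> h \<in> carrier H \<and> h \<noteq> \<one>\<^bsub>H\<^esub>"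
  "Inr k \<in> letters H K \<longleftrightarrow> k \<in> carrier K \<and> k \<noteq> \<one>\<^bsub>K\<^esub>"
  by auto

lemma length_letter_mult: "length (letter_mult H K x w) \<le> Suc (length w)"
  by (induction H K x w rule: letter_mult.induct) auto

lemma length_free_mult: "length (foldr (letter_mult H K) u v) \<le> length u + length v"
proof (induction u)
  case (Cons x u)
  then show ?case
    using length_letter_mult[of H K x "foldr (letter_mult H K) u v"] by simp
qed simp

lemma Nil_reduced [simp]: "[] \<in> reduced_words H K"
  by (simp add: reduced_words_def)

lemma singleton_reduced [simp]: "[x] \<in> reduced_words H K \<longleftrightarrow> x \<in> letters H K"
  by (simp add: reduced_words_def)

lemma reduced_Cons:
  "x # w \<in> reduced_words H K \<longleftrightarrow>
     x \<in> letters H K \<and> w \<in> reduced_words H K \<and> (w = [] \<or> isl x \<noteq> isl (hd w))"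
  by (auto simp: reduced_words_def successively_Cons)

lemma letter_mult_reduced: "x # w \<in> reduced_words H K \<Longrightarrow> letter_mult H K x w = x # w"
  by (cases w) (auto simp: reduced_Cons letter_mult_alternating)

lemma reduced_appendD:
  assumes "u @ v \<in> reduced_words H K"
  shows "u \<in> reduced_words H K" "v \<in> reduced_words H K"
  using assms by (auto simp: reduced_words_def successively_append_iff)

text \<open>In a reduced word neighbouring letters lie in different factors, so nothing merges or
  cancels.\<close>

lemma free_mult_reduced:
  "u @ v \<in> reduced_words H K \<Longrightarrow> foldr (letter_mult H K) u v = u @ v"
  by (induction u) (auto simp: letter_mult_reduced reduced_Cons)

lemma finite_reduced:
  assumes "finite (carrier H)" "finite (carrier K)"
  shows "finite {w \<in> reduced_words H K. length w \<le> n}"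
proof (rule finite_subset)
  show "{w \<in> reduced_words H K. length w \<le> n} \<subseteq> {w. set w \<subseteq> letters H K \<and> length w \<le> n}"
    by (auto simp: reduced_words_def)
  show "finite {w. set w \<subseteq> letters H K \<and> length w \<le> n}"
    using assms by (intro finite_lists_length_le) simp
qed

section \<open>The free product as a group of reduced words\<close>

locale free_product_groups = H: group H + K: group K
  for H :: "('h, 'm) monoid_scheme" and K :: "('k, 'n) monoid_scheme"
begin

abbreviation "B \<equiv> free_product H K"
abbreviation "lm \<equiv> letter_mult H K"

lemma letter_mult_closed:
  assumes "x \<in> letters H K" "w \<in> reduced_words H K"
  shows "lm x w \<in> reduced_words H K"
proof (cases w)
  case Nil
  then show ?thesis using assms by simp
next
  case (Cons y v)
  then show ?thesis
    using assms by (cases x; cases y) (auto simp: reduced_Cons)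
qed

lemma free_mult_closed:
  assumes "u \<in> reduced_words H K" "v \<in> reduced_words H K"
  shows "foldr lm u v \<in> reduced_words H K"
  using assms by (induction u) (auto simp: reduced_Cons letter_mult_closed)

text \<open>Left multiplication by letters of \<open>H\<close> acts on reduced words. Only a word
  starting in \<open>H\<close> needs a computation, and that one takes place in its first letter, by
  associativity in \<open>H\<close>. Associativity of the free product is reduced to this and to
  \<open>letter_action_inr\<close>.\<close>

lemma letter_action_inl:
  assumes h: "h \<in> carrier H" "h' \<in> carrier H" "h \<noteq> \<one>\<^bsub>H\<^esub>" and w: "w \<in> reduced_words H K"
  shows "lm (Inl h) (lm (Inl h') w) =
    (if h \<otimes>\<^bsub>H\<^esub> h' = \<one>\<^bsub>H\<^esub> then w else lm (Inl (h \<otimes>\<^bsub>H\<^esub> h')) w)"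
proof (cases "\<exists>h'' v. w = Inl h'' # v")
  case False
  then have "lm (Inl g) w = Inl g # w" for g
    by (cases w; cases "hd w") auto
  then show ?thesis by simp
next
  case True
  then obtain h'' v where w_eq: "w = Inl h'' # v"
    by blast
  then have h'': "h'' \<in> carrier H" "h'' \<noteq> \<one>\<^bsub>H\<^esub>" and v: "v = [] \<or> \<not> isl (hd v)"
    using w by (auto simp: reduced_Cons)
  have lm_v: "lm (Inl g) v = Inl g # v" for g
    using v by (cases v; cases "hd v") auto
  have "h = h''" if "h \<otimes>\<^bsub>H\<^esub> h' = \<one>\<^bsub>H\<^esub>" "h' \<otimes>\<^bsub>H\<^esub> h'' = \<one>\<^bsub>H\<^esub>"
    using that h h'' by (metis H.l_one H.m_assoc H.r_one)
  moreover have "h \<otimes>\<^bsub>H\<^esub> (h' \<otimes>\<^bsub>H\<^esub> h'') = h \<otimes>\<^bsub>H\<^esub> h' \<otimes>\<^bsub>H\<^esub> h''"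
    using h h'' by (simp add: H.m_assoc)
  moreover have "h \<otimes>\<^bsub>H\<^esub> h' \<otimes>\<^bsub>H\<^esub> h'' = h" if "h' \<otimes>\<^bsub>H\<^esub> h'' = \<one>\<^bsub>H\<^esub>"
    using that h h'' by (simp add: H.m_assoc)
  ultimately show ?thesis
    using h h'' by (auto simp: w_eq lm_v)
qed

lemma letter_action_inr:
  assumes k: "k \<in> carrier K" "k' \<in> carrier K" "k \<noteq> \<one>\<^bsub>K\<^esub>" and w: "w \<in> reduced_words H K"
  shows "lm (Inr k) (lm (Inr k') w) =
    (if k \<otimes>\<^bsub>K\<^esub> k' = \<one>\<^bsub>K\<^esub> then w else lm (Inr (k \<otimes>\<^bsub>K\<^esub> k')) w)"
proof (cases "\<exists>k'' v. w = Inr k'' # v")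
  case False
  then have "lm (Inr g) w = Inr g # w" for g
    by (cases w; cases "hd w") auto
  then show ?thesis by simp
next
  case True
  then obtain k'' v where w_eq: "w = Inr k'' # v"
    by blast
  then have k'': "k'' \<in> carrier K" "k'' \<noteq> \<one>\<^bsub>K\<^esub>" and v: "v = [] \<or> isl (hd v)"
    using w by (auto simp: reduced_Cons)
  have lm_v: "lm (Inr g) v = Inr g # v" for g
    using v by (cases v; cases "hd v") auto
  have "k = k''" if "k \<otimes>\<^bsub>K\<^esub> k' = \<one>\<^bsub>K\<^esub>" "k' \<otimes>\<^bsub>K\<^esub> k'' = \<one>\<^bsub>K\<^esub>"
    using that k k'' by (metis K.l_one K.m_assoc K.r_one)
  moreover have "k \<otimes>\<^bsub>K\<^esub> (k' \<otimes>\<^bsub>K\<^esub> k'') = k \<otimes>\<^bsub>K\<^esub> k' \<otimes>\<^bsub>K\<^esub> k''"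
    using k k'' by (simp add: K.m_assoc)
  moreover have "k \<otimes>\<^bsub>K\<^esub> k' \<otimes>\<^bsub>K\<^esub> k'' = k" if "k' \<otimes>\<^bsub>K\<^esub> k'' = \<one>\<^bsub>K\<^esub>"
    using that k k'' by (simp add: K.m_assoc)
  ultimately show ?thesis
    using k k'' by (auto simp: w_eq lm_v)
qed

text \<open>Let \<open>y\<close> be the first letter of \<open>v\<close>. If \<open>x\<close> and
  \<open>y\<close> lie in different factors they are merely juxtaposed; otherwise the action lemmas
  apply to the product of the rest of \<open>v\<close> with \<open>z\<close>.\<close>

lemma letter_mult_assoc:
  assumes x: "x \<in> letters H K" and v: "v \<in> reduced_words H K" and z: "z \<in> reduced_words H K"
  shows "foldr lm (lm x v) z = lm x (foldr lm v z)"
proof (cases v)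
  case Nil
  then show ?thesis by simp
next
  case (Cons y v')
  have y: "y \<in> letters H K" and v': "v' \<in> reduced_words H K"
    using v by (auto simp: Cons reduced_Cons)
  note closed = free_mult_closed[OF v' z]
  show ?thesis
    using x y letter_action_inl[OF _ _ _ closed] letter_action_inr[OF _ _ _ closed]
    by (cases x; cases y) (auto simp: Cons)
qed

lemma free_mult_assoc:
  assumes "u \<in> reduced_words H K" "v \<in> reduced_words H K" "z \<in> reduced_words H K"
  shows "foldr lm (foldr lm u v) z = foldr lm u (foldr lm v z)"
  using assms by (induction u) (auto simp: reduced_Cons letter_mult_assoc free_mult_closed)

lemma letter_inv_closed: "x \<in> letters H K \<Longrightarrow> letter_inv H K x \<in> letters H K"
  by (auto simp: letter_inv_def)

lemma free_inverse_closed: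
  assumes "w \<in> reduced_words H K"
  shows "rev (map (letter_inv H K) w) \<in> reduced_words H K"
proof -
  have "successively (\<lambda>x y. isl y \<noteq> isl x) w"
    using assms by (auto simp: reduced_words_def elim: successively_mono)
  then show ?thesis
    using assms letter_inv_closed
    by (auto simp: reduced_words_def successively_map simp del: Plus_def)
qed

lemma free_l_inv:
  assumes "w \<in> reduced_words H K"
  shows "foldr lm (rev (map (letter_inv H K) w)) w = []"
  using assms
proof (induction w)
  case (Cons x w)
  have "lm (letter_inv H K x) (x # w) = w"
    using Cons.prems by (cases x) (auto simp: letter_inv_def reduced_Cons)
  then show ?case
    using Cons by (simp add: reduced_Cons)
qed simp

lemma group_free_product: "group B"
proof (rule groupI)
  fix w assume "w \<in> carrier B"
  then show "\<exists>v\<in>carrier B. v \<otimes>\<^bsub>B\<^esub> w = \<one>\<^bsub>B\<^esub>"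
    using free_inverse_closed free_l_inv
    by (intro bexI[of _ "rev (map (letter_inv H K) w)"]) simp_all
qed (simp_all add: free_mult_closed free_mult_assoc)

lemma inv_free_product:
  "w \<in> reduced_words H K \<Longrightarrow> inv\<^bsub>B\<^esub> w = rev (map (letter_inv H K) w)"
  by (intro group.inv_equality[OF group_free_product])
    (simp_all add: free_l_inv free_inverse_closed)

text \<open>The inverse begins with the inverse of the last letter of \<open>w\<close>. This
  provides the hypothesis of \<open>tour_swap\<close> that tours enter the coset of \<open>w\<close>
  at \<open>w\<close> itself.\<close>

lemma side_proj_inv:
  assumes "w \<in> reduced_words H K" "w = [] \<or> isl (last w) \<noteq> left"
  shows "side_proj left (inv\<^bsub>B\<^esub> w) = []"
  using assms by (cases w rule: rev_cases) (auto simp: inv_free_product)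

text \<open>Multiplying by a letter on the right affects only the end of a reduced word, so the
  first letter stays in its factor unless the whole product vanishes.\<close>

lemma free_mult_letter_head:
  assumes "w \<in> reduced_words H K" "w \<noteq> []"
  shows "foldr lm w [x] = [] \<or> isl (hd (foldr lm w [x])) = isl (hd w)"
  using assms
proof (induction w)
  case (Cons y w)
  show ?case
  proof (cases "w = []")
    case True
    then show ?thesis
      by (cases "isl y = isl x")
        (use letter_mult_same_side[of y x H K "[]"] in \<open>auto simp: letter_mult_alternating\<close>)
  next
    case False
    with Cons have "foldr lm w [x] = [] \<or> isl (hd (foldr lm w [x])) \<noteq> isl y"
      by (auto simp: reduced_Cons)
    then have "lm y (foldr lm w [x]) = y # foldr lm w [x]"
      by (cases "foldr lm w [x]") (auto simp: letter_mult_alternating)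
    then show ?thesis by simp
  qed
qed simp

text \<open>The projection depends only on the first letter. A letter on the right can alter a first
  letter of side \<open>left\<close> only when no other letter stands between them and both lie in
  the same factor, that is, along an edge of the copy of the factor.\<close>

lemma side_proj_mult_letter:
  assumes w: "w \<in> reduced_words H K"
    and not_edge: "\<not> ((w = [] \<or> (\<exists>y. w = [y] \<and> isl y = left)) \<and> isl x = left)"
  shows "side_proj left (foldr lm w [x]) = side_proj left w"
proof (cases w)
  case Nil
  then show ?thesis using not_edge by simp
next
  case (Cons y v)
  show ?thesis
  proof (cases "isl y = left")
    case False
    then show ?thesis
      using free_mult_letter_head[OF w, of x] Cons
      by (cases "foldr lm w [x]") auto
  next
    case True
    \<comment> \<open>What follows \<open>y\<close> is still empty or begins in the other factor, so
      \<open>y\<close> itself is unchanged.\<close>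
    have "foldr lm v [x] = [] \<or> isl (hd (foldr lm v [x])) \<noteq> isl y"
    proof (cases "v = []")
      case True
      then show ?thesis using not_edge \<open>isl y = left\<close> Cons by auto
    next
      case False
      then show ?thesis
        using free_mult_letter_head[of v x] w Cons by (auto simp: reduced_Cons)
    qed
    then have "lm y (foldr lm v [x]) = y # foldr lm v [x]"
      by (cases "foldr lm v [x]") (auto simp: letter_mult_alternating)
    then show ?thesis
      using Cons True by simp
  qed
qed

section \<open>The two factors inside the free product\<close>

lemma free_inl_hom: "free_inl H \<in> hom H B"
  by (auto simp: hom_def free_inl_def)

lemma free_inr_hom: "free_inr K \<in> hom K B"
  by (auto simp: hom_def free_inr_def)

lemma inj_free_inl: "inj_on (free_inl H) T"
  by (auto simp: inj_on_def free_inl_def split: if_splits)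

lemma inj_free_inr: "inj_on (free_inr K) T"
  by (auto simp: inj_on_def free_inr_def split: if_splits)

lemma free_inl_image:
  "w \<in> free_inl H ` carrier H \<longleftrightarrow> w \<in> reduced_words H K \<and> (w = [] \<or> (\<exists>y. w = [y] \<and> isl y))"
proof
  assume "w \<in> reduced_words H K \<and> (w = [] \<or> (\<exists>y. w = [y] \<and> isl y))"
  then consider "w = free_inl H \<one>\<^bsub>H\<^esub>" | h where "h \<in> carrier H" "w = free_inl H h"
    by (force simp: free_inl_def isl_def)
  then show "w \<in> free_inl H ` carrier H"
    by cases auto
qed (auto simp: free_inl_def)

lemma free_inr_image:
  "w \<in> free_inr K ` carrier K \<longleftrightarrow> w \<in> reduced_words H K \<and> (w = [] \<or> (\<exists>y. w = [y] \<and> \<not> isl y))"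
proof
  assume w: "w \<in> reduced_words H K \<and> (w = [] \<or> (\<exists>y. w = [y] \<and> \<not> isl y))"
  then consider "w = free_inr K \<one>\<^bsub>K\<^esub>" | k where "k \<in> carrier K" "w = free_inr K k"
    by (cases "hd w") (force simp: free_inr_def)+
  then show "w \<in> free_inr K ` carrier K"
    by cases auto
qed (auto simp: free_inr_def)

lemma side_proj_in:
  assumes "w \<in> reduced_words H K"
  shows "side_proj True w \<in> free_inl H ` carrier H" "side_proj False w \<in> free_inr K ` carrier K"
  using assms by (cases w; auto simp: free_inl_image free_inr_image reduced_Cons)+

end

section \<open>Generators of the free product\<close>

locale free_product_gens = H: generated_group H SH + K: generated_group K SK
  for H :: "('h, 'm) monoid_scheme" and SH and K :: "('k, 'n) monoid_scheme" and SK
begin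

sublocale free_product_groups H K ..

definition M where "M = free_inl H ` SH \<union> free_inr K ` SK"

interpretation grp: group B
  by (rule group_free_product)

text \<open>No equality here: a generating set may contain the identity, which is embedded as the
  empty word.\<close>

lemma length_gen: "m \<in> M \<Longrightarrow> length m \<le> 1"
  by (auto simp: M_def free_inl_def free_inr_def)

lemma free_inl_generate:
  assumes "h \<in> carrier H"
  shows "free_inl H h \<in> generate B M"
proof -
  have "h \<in> generate H SH"
    using assms H.generate_gens by simp
  then show ?thesis
  proof induction
    case one
    then show ?case using generate.one[of B M] by (simp add: free_inl_def)
  next
    case (eng h1 h2)
    then have "h1 \<in> carrier H" "h2 \<in> carrier H"
      using H.generate_gens by auto
    then show ?case
      using generate.eng[OF eng.IH] hom_mult[OF free_inl_hom] by simp
  qed (auto intro!: generate.incl simp: M_def H.gens_inv)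
qed

lemma free_inr_generate:
  assumes "k \<in> carrier K"
  shows "free_inr K k \<in> generate B M"
proof -
  have "k \<in> generate K SK"
    using assms K.generate_gens by simp
  then show ?thesis
  proof induction
    case one
    then show ?case using generate.one[of B M] by (simp add: free_inr_def)
  next
    case (eng k1 k2)
    then have "k1 \<in> carrier K" "k2 \<in> carrier K"
      using K.generate_gens by auto
    then show ?case
      using generate.eng[OF eng.IH] hom_mult[OF free_inr_hom] by simp
  qed (auto intro!: generate.incl simp: M_def K.gens_inv)
qed

lemma reduced_generate: "w \<in> reduced_words H K \<Longrightarrow> w \<in> generate B M"
proof (induction w)
  case Nil
  then show ?case using generate.one[of B M] by simp
next
  case (Cons x w)
  have "[x] \<in> generate B M"
  proof (cases x)
    case (Inl h)
    then show ?thesis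
      using free_inl_generate[of h] Cons.prems by (simp add: reduced_Cons free_inl_def)
  next
    case (Inr k)
    then show ?thesis
      using free_inr_generate[of k] Cons.prems by (simp add: reduced_Cons free_inr_def)
  qed
  then have "[x] \<otimes>\<^bsub>B\<^esub> w \<in> generate B M"
    using Cons by (intro generate.eng) (auto simp: reduced_Cons)
  then show ?case
    using Cons.prems by (simp add: letter_mult_reduced)
qed

lemma gens_reduced: "M \<subseteq> reduced_words H K"
  by (auto simp: M_def free_inl_def free_inr_def)

lemma fin_sym_generating_M: "fin_sym_generating B M"
proof -
  have "inv\<^bsub>B\<^esub> m \<in> M" if m: "m \<in> M" for m
  proof -
    have "inv\<^bsub>B\<^esub> (free_inl H h) = free_inl H (inv\<^bsub>H\<^esub> h)" if "h \<in> SH" for h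
      using that by (auto simp: inv_free_product free_inl_def letter_inv_def)
    moreover have "inv\<^bsub>B\<^esub> (free_inr K k) = free_inr K (inv\<^bsub>K\<^esub> k)" if "k \<in> SK" for k
      using that by (auto simp: inv_free_product free_inr_def letter_inv_def)
    ultimately show ?thesis
      using m by (auto simp: M_def H.gens_inv K.gens_inv)
  qed
  moreover have "generate B M \<subseteq> carrier B"
    using gens_reduced by (intro grp.generate_incl) simp
  then have "generate B M = carrier B"
    using reduced_generate by auto
  ultimately show ?thesis
    using H.finite_gens K.finite_gens gens_reduced
    by (auto simp: fin_sym_generating_def M_def)
qed

sublocale B: generated_group B M
  by unfold_locales (rule fin_sym_generating_M)

lemma side_proj_move:
  assumes w: "w \<in> reduced_words H K" and m: "m \<in> M"
  shows "\<not> (w \<in> free_inl H ` carrier H \<and> m \<in> free_inl H ` SH) \<Longrightarrow>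
      side_proj True (w \<otimes>\<^bsub>B\<^esub> m) = side_proj True w"
    and "\<not> (w \<in> free_inr K ` carrier K \<and> m \<in> free_inr K ` SK) \<Longrightarrow>
      side_proj False (w \<otimes>\<^bsub>B\<^esub> m) = side_proj False w"
proof -
  have "w \<otimes>\<^bsub>B\<^esub> [] = w"
    using grp.r_one[of w] w by simp
  \<comment> \<open>A trivial generator does not move at all; any other one is a single letter from
    the factor given by \<open>isl\<close>.\<close>
  moreover have "m = [] \<or> (\<exists>x. m = [x] \<and> (isl x \<longrightarrow> m \<in> free_inl H ` SH) \<and>
      (\<not> isl x \<longrightarrow> m \<in> free_inr K ` SK))"
    using m by (auto simp: M_def free_inl_def free_inr_def)
  ultimately show
    "\<not> (w \<in> free_inl H ` carrier H \<and> m \<in> free_inl H ` SH) \<Longrightarrow>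
      side_proj True (w \<otimes>\<^bsub>B\<^esub> m) = side_proj True w"
    "\<not> (w \<in> free_inr K ` carrier K \<and> m \<in> free_inr K ` SK) \<Longrightarrow>
      side_proj False (w \<otimes>\<^bsub>B\<^esub> m) = side_proj False w"
    using w side_proj_mult_letter[OF w, of True] side_proj_mult_letter[OF w, of False]
    by (auto simp: free_inl_image free_inr_image)
qed

text \<open>A generator has at most one letter, so each move lengthens a reduced word by at most
  one.\<close>

lemma length_visits:
  "set ms \<subseteq> M \<Longrightarrow> v \<in> visits B u ms \<Longrightarrow> length v \<le> length u + length ms"
proof (induction ms arbitrary: u)
  case (Cons m ms)
  have "length (u \<otimes>\<^bsub>B\<^esub> m) \<le> length u + 1"
    using length_free_mult[of H K u m] length_gen[of m] Cons.prems by simp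
  then show ?case
    using Cons.IH[of "u \<otimes>\<^bsub>B\<^esub> m"] Cons.prems by fastforce
qed simp

end

section \<open>Depth\<close>

lemma depth_geI:
  assumes "1 \<le> n"
    and "\<And>ws. set ws \<subseteq> S \<Longrightarrow> length ws \<le> n \<Longrightarrow>
      word_length G S (g \<otimes>\<^bsub>G\<^esub> word_prod G ws) \<le> word_length G S g"
  shows "enat n \<le> depth G S g"
  unfolding depth_def using assms by (intro Sup_upper) blast

text \<open>The set in \<open>depth\<close> is downward closed, so a word of length at most
  \<open>n\<close> that violates the bound keeps all its members, and with them the supremum, at or
  below \<open>n - 1\<close>.\<close>

lemma depth_geD:
  assumes depth: "enat n \<le> depth G S g" and n: "1 \<le> n" and ws: "set ws \<subseteq> S" "length ws \<le> n"
  shows "word_length G S (g \<otimes>\<^bsub>G\<^esub> word_prod G ws) \<le> word_length G S g"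
proof (rule ccontr)
  assume contra: "\<not> ?thesis"
  have "depth G S g \<le> enat (n - 1)"
    unfolding depth_def
  proof (rule Sup_least)
    fix e
    assume "e \<in> {enat m | m. 1 \<le> m \<and> (\<forall>ws. set ws \<subseteq> S \<and> length ws \<le> m \<longrightarrow>
      word_length G S (g \<otimes>\<^bsub>G\<^esub> word_prod G ws) \<le> word_length G S g)}"
    then obtain m where m: "e = enat m" "\<forall>ws. set ws \<subseteq> S \<and> length ws \<le> m \<longrightarrow>
      word_length G S (g \<otimes>\<^bsub>G\<^esub> word_prod G ws) \<le> word_length G S g"
      by blast
    then have "m < length ws"
      using contra ws(1) by (meson not_le)
    then show "e \<le> enat (n - 1)"
      using m(1) ws(2) by simp
  qed
  then have "enat n \<le> enat (n - 1)"
    using depth by (rule order_trans[rotated])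
  then show False
    using n by simp
qed

text \<open>Replaces suprema and dead ends by a plain condition on short words. Of \<open>G\<close>
  it asks only a right identity law on \<open>S\<close>, which for the wreath product is checked
  directly on the generators in \<open>gens_r_one\<close>.\<close>

lemma unbounded_depth_iff:
  assumes r_one: "\<And>s. s \<in> S \<Longrightarrow> s \<otimes>\<^bsub>G\<^esub> \<one>\<^bsub>G\<^esub> = s"
  shows "unbounded_depth G S \<longleftrightarrow> (\<forall>n. \<exists>g\<in>carrier G. \<forall>ws. set ws \<subseteq> S \<and> length ws \<le> n \<longrightarrow>
    word_length G S (g \<otimes>\<^bsub>G\<^esub> word_prod G ws) \<le> word_length G S g)" (is "_ \<longleftrightarrow> (\<forall>n. ?deep n)")
proof
  assume unbounded: "unbounded_depth G S"
  show "\<forall>n. ?deep n"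
  proof
    fix n
    \<comment> \<open>One more than \<open>n\<close>, because \<open>depth\<close> tests only
      lengths from 1 on.\<close>
    obtain g where "dead_end G S g" "enat (Suc n) \<le> depth G S g"
      using unbounded unfolding unbounded_depth_def by blast
    then show "?deep n"
      using depth_geD[of "Suc n" G S g] unfolding dead_end_def by (intro bexI[of _ g]) auto
  qed
next
  assume deep: "\<forall>n. ?deep n"
  show "unbounded_depth G S"
    unfolding unbounded_depth_def
  proof
    fix n :: nat
    obtain g where g: "g \<in> carrier G" "\<And>ws. set ws \<subseteq> S \<Longrightarrow> length ws \<le> Suc n \<Longrightarrow>
      word_length G S (g \<otimes>\<^bsub>G\<^esub> word_prod G ws) \<le> word_length G S g"
      using deep by meson
    have "dead_end G S g"
      using g g(2)[of "[s]" for s] r_one by (simp add: dead_end_def)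
    moreover have "enat (Suc n) \<le> depth G S g"
      using g by (intro depth_geI) auto
    then have "enat n \<le> depth G S g"
      by (rule order_trans[rotated]) simp
    ultimately show "\<exists>g. dead_end G S g \<and> enat n \<le> depth G S g"
      by blast
  qed
qed

section \<open>Word length in a wreath product\<close>

locale wreath = A: generated_group A SA + B: generated_group B M
  for A :: "('a, 'm) monoid_scheme" and SA and B :: "('b, 'n) monoid_scheme" and M
begin

abbreviation "W \<equiv> wreath_product A B"

definition gens where "gens = wreath_lamp A B ` SA \<union> wreath_base A B ` M"

definition lamps where "lamps = carrier (lamp_group A B)"

definition supp where "supp f = {x \<in> carrier B. f x \<noteq> \<one>\<^bsub>A\<^esub>}"

definition cost where "cost f = (\<Sum>x\<in>supp f. word_length A SA (f x))"

lemma lamps_iff: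
  "f \<in> lamps \<longleftrightarrow> (\<forall>x\<in>carrier B. f x \<in> carrier A) \<and> f \<in> extensional (carrier B) \<and> finite (supp f)"
  using carrier_sum_group[of "carrier B" "\<lambda>_. A"] A.is_group
  by (auto simp: lamps_def supp_def PiE_def)

lemma lamps_closed: "f \<in> lamps \<Longrightarrow> x \<in> carrier B \<Longrightarrow> f x \<in> carrier A"
  by (auto simp: lamps_iff)

lemma supp_closed: "supp f \<subseteq> carrier B"
  by (auto simp: supp_def)

lemma finite_supp: "f \<in> lamps \<Longrightarrow> finite (supp f)"
  by (auto simp: lamps_iff)

lemma cost_superset:
  assumes "finite T" "T \<subseteq> carrier B" "supp f \<subseteq> T"
  shows "cost f = (\<Sum>x\<in>T. word_length A SA (f x))"
  unfolding cost_def using assms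
  by (intro sum.mono_neutral_left) (auto simp: supp_def)

lemma carrier_W: "carrier W = lamps \<times> carrier B"
  by (simp add: wreath_product_def lamps_def)

lemma mult_W:
  "(f, b) \<otimes>\<^bsub>W\<^esub> (f', b') =
    ((\<lambda>x\<in>carrier B. f x \<otimes>\<^bsub>A\<^esub> shift B b f' x), b \<otimes>\<^bsub>B\<^esub> b')"
  by (simp add: wreath_product_def)

lemma one_W: "\<one>\<^bsub>W\<^esub> = ((\<lambda>x\<in>carrier B. \<one>\<^bsub>A\<^esub>), \<one>\<^bsub>B\<^esub>)"
  by (simp add: wreath_product_def)

lemma one_lamps: "(\<lambda>x\<in>carrier B. \<one>\<^bsub>A\<^esub>) \<in> lamps"
  by (auto simp: lamps_iff supp_def)

lemma supp_one: "supp (\<lambda>x\<in>carrier B. \<one>\<^bsub>A\<^esub>) = {}"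
  by (auto simp: supp_def)

lemma shift_apply: "x \<in> carrier B \<Longrightarrow> shift B b f x = f (inv\<^bsub>B\<^esub> b \<otimes>\<^bsub>B\<^esub> x)"
  by (simp add: shift_def)

lemma supp_shift:
  assumes "b \<in> carrier B"
  shows "supp (shift B b f) = (\<otimes>\<^bsub>B\<^esub>) b ` supp f"
proof
  show "supp (shift B b f) \<subseteq> (\<otimes>\<^bsub>B\<^esub>) b ` supp f"
  proof
    fix x assume "x \<in> supp (shift B b f)"
    then have "x \<in> carrier B" "inv\<^bsub>B\<^esub> b \<otimes>\<^bsub>B\<^esub> x \<in> supp f" "x = b \<otimes>\<^bsub>B\<^esub> (inv\<^bsub>B\<^esub> b \<otimes>\<^bsub>B\<^esub> x)"
      using assms by (auto simp: supp_def shift_apply B.m_assoc[symmetric])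
    then show "x \<in> (\<otimes>\<^bsub>B\<^esub>) b ` supp f"
      by blast
  qed
  show "(\<otimes>\<^bsub>B\<^esub>) b ` supp f \<subseteq> supp (shift B b f)"
    using assms by (auto simp: supp_def shift_apply B.m_assoc[symmetric])
qed

lemma shift_lamps:
  assumes "b \<in> carrier B" "f \<in> lamps"
  shows "shift B b f \<in> lamps"
  using assms supp_shift[of b f] by (auto simp: lamps_iff shift_def)

lemma sum_shift:
  assumes "b \<in> carrier B" "T \<subseteq> carrier B"
  shows "(\<Sum>x\<in>(\<otimes>\<^bsub>B\<^esub>) b ` T. word_length A SA (shift B b f x)) = (\<Sum>x\<in>T. word_length A SA (f x))"
proof -
  have "inj_on ((\<otimes>\<^bsub>B\<^esub>) b) T"
    using assms by (auto simp: inj_on_def subset_eq)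
  then show ?thesis
    using assms
    by (auto simp: sum.reindex shift_apply subset_eq B.m_assoc[symmetric] intro!: sum.cong)
qed

lemma shift_inv_shift:
  assumes "b \<in> carrier B" "f \<in> extensional (carrier B)"
  shows "shift B b (shift B (inv\<^bsub>B\<^esub> b) f) = f"
  using assms by (auto simp: shift_def fun_eq_iff extensional_def B.m_assoc[symmetric])

text \<open>\<open>word_prod\<close> multiplies from the left, so a lamp generator always acts at
  the identity, and in \<open>base_mult\<close> a move shifts the lamps instead of the
  lamplighter.\<close>

lemma lamp_mult:
  assumes "a \<in> carrier A" "f \<in> lamps" "b \<in> carrier B"
  shows "wreath_lamp A B a \<otimes>\<^bsub>W\<^esub> (f, b) = (f(\<one>\<^bsub>B\<^esub> := a \<otimes>\<^bsub>A\<^esub> f \<one>\<^bsub>B\<^esub>), b)"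
proof -
  have "f \<in> extensional (carrier B)" "\<And>x. x \<in> carrier B \<Longrightarrow> f x \<in> carrier A"
    using assms by (auto simp: lamps_iff)
  then show ?thesis
    using assms by (auto simp: wreath_lamp_def mult_W shift_apply fun_eq_iff extensional_def)
qed

lemma base_mult:
  assumes "m \<in> carrier B" "f \<in> lamps"
  shows "wreath_base A B m \<otimes>\<^bsub>W\<^esub> (f, b) = (shift B m f, m \<otimes>\<^bsub>B\<^esub> b)"
proof -
  have "shift B m f \<in> lamps"
    using shift_lamps assms by blast
  then have "shift B m f \<in> extensional (carrier B)" "\<And>x. x \<in> carrier B \<Longrightarrow> shift B m f x \<in> carrier A"
    by (auto simp: lamps_iff)
  then show ?thesis
    by (auto simp: wreath_base_def mult_W fun_eq_iff extensional_def)
qed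

lemma gens_r_one:
  assumes "s \<in> gens"
  shows "s \<otimes>\<^bsub>W\<^esub> \<one>\<^bsub>W\<^esub> = s"
proof -
  consider a where "a \<in> SA" "s = wreath_lamp A B a" | m where "m \<in> M" "s = wreath_base A B m"
    using assms by (auto simp: gens_def)
  then show ?thesis
  proof cases
    case 1
    then show ?thesis
      using lamp_mult[OF _ one_lamps, of a "\<one>\<^bsub>B\<^esub>"]
      by (auto simp: one_W wreath_lamp_def fun_eq_iff)
  next
    case 2
    then show ?thesis
      using base_mult[OF _ one_lamps, of m "\<one>\<^bsub>B\<^esub>"]
      by (auto simp: one_W wreath_base_def shift_def fun_eq_iff)
  qed
qed

lemma update_lamps:
  assumes "f \<in> lamps" "a \<in> carrier A" "x \<in> carrier B"
  shows "f(x := a) \<in> lamps"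
proof -
  have "supp (f(x := a)) \<subseteq> insert x (supp f)"
    by (auto simp: supp_def)
  then show ?thesis
    using assms finite_subset by (fastforce simp: lamps_iff extensional_def)
qed

text \<open>The lower bound for word length: the base letters form the path, and each lamp letter
  lengthens one lamp by at most one. The bound is stated for every finite \<open>T\<close>, so that
  it survives shifts and can later be used for the empty set and for a single point.\<close>

lemma word_imp_path:
  assumes "set ws \<subseteq> gens"
  shows "\<exists>f ms. word_prod W ws = (f, word_prod B ms) \<and> f \<in> lamps \<and> set ms \<subseteq> M \<and>
    supp f \<subseteq> visits B \<one>\<^bsub>B\<^esub> ms \<and>
    (\<forall>T. finite T \<and> T \<subseteq> carrier B \<longrightarrow>
      (\<Sum>x\<in>T. word_length A SA (f x)) + length ms \<le> length ws)"
  using assms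
proof (induction ws)
  case Nil
  show ?case
    using one_lamps
    by (intro exI[of _ "\<lambda>x\<in>carrier B. \<one>\<^bsub>A\<^esub>"] exI[of _ "[]"])
      (simp add: one_W supp_one subset_eq del: restrict_apply, simp)
next
  case (Cons s ws)
  then obtain f ms where IH: "word_prod W ws = (f, word_prod B ms)" "f \<in> lamps" "set ms \<subseteq> M"
    "supp f \<subseteq> visits B \<one>\<^bsub>B\<^esub> ms"
    "\<And>T. finite T \<Longrightarrow> T \<subseteq> carrier B \<Longrightarrow>
      (\<Sum>x\<in>T. word_length A SA (f x)) + length ms \<le> length ws"
    by auto
  have ms: "word_prod B ms \<in> carrier B" "set ms \<subseteq> carrier B"
    using IH(3) by (auto simp: B.word_closed)
  consider a where "a \<in> SA" "s = wreath_lamp A B a" | m where "m \<in> M" "s = wreath_base A B m"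
    using Cons.prems by (auto simp: gens_def)
  then show ?case
  proof cases
    case 1
    let ?f = "f(\<one>\<^bsub>B\<^esub> := a \<otimes>\<^bsub>A\<^esub> f \<one>\<^bsub>B\<^esub>)"
    have f1: "f \<one>\<^bsub>B\<^esub> \<in> carrier A"
      using lamps_closed IH(2) by simp
    have "word_prod W (s # ws) = (?f, word_prod B ms)"
      using 1 IH ms lamp_mult by simp
    moreover have "?f \<in> lamps"
      using update_lamps IH(2) f1 1 by simp
    moreover have "supp ?f \<subseteq> visits B \<one>\<^bsub>B\<^esub> ms"
      using IH(4) by (auto simp: supp_def)
    moreover have "(\<Sum>x\<in>T. word_length A SA (?f x)) + length ms \<le> length (s # ws)"
      if T: "finite T" "T \<subseteq> carrier B" for T
    proof -
      have "(\<Sum>x\<in>T. word_length A SA (?f x))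
        \<le> (\<Sum>x\<in>T. word_length A SA (f x) + (if x = \<one>\<^bsub>B\<^esub> then 1 else 0))"
        using A.word_length_gen_mult[of a "f \<one>\<^bsub>B\<^esub>"] 1 f1 by (intro sum_mono) auto
      also have "\<dots> \<le> (\<Sum>x\<in>T. word_length A SA (f x)) + 1"
        using T by (simp add: sum.distrib)
      finally show ?thesis
        using IH(5)[OF T] by simp
    qed
    ultimately show ?thesis
      using IH(3) by blast
  next
    case 2
    have m: "m \<in> carrier B"
      using 2 by auto
    have "word_prod W (s # ws) = (shift B m f, word_prod B (m # ms))"
      using 2 IH base_mult by simp
    moreover have "supp (shift B m f) \<subseteq> visits B \<one>\<^bsub>B\<^esub> (m # ms)"
      using IH(4) B.visits_translate[OF m B.one_closed ms(2)] m
      by (auto simp: supp_shift)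
    moreover have "(\<Sum>x\<in>T. word_length A SA (shift B m f x)) + length (m # ms) \<le> length (s # ws)"
      if T: "finite T" "T \<subseteq> carrier B" for T
    proof -
      \<comment> \<open>Undoing the shift turns the sum over \<open>T\<close> into a sum over
        \<open>?T\<close>, to which the induction hypothesis applies.\<close>
      let ?T = "(\<otimes>\<^bsub>B\<^esub>) (inv\<^bsub>B\<^esub> m) ` T"
      have "(\<otimes>\<^bsub>B\<^esub>) m ` ?T = T"
        using T m by (force simp: image_image B.m_assoc[symmetric] subset_eq)
      moreover have "?T \<subseteq> carrier B"
        using T m by auto
      ultimately have "(\<Sum>x\<in>T. word_length A SA (shift B m f x)) = (\<Sum>x\<in>?T. word_length A SA (f x))"
        using sum_shift[OF m, of ?T f] by simp
      then show ?thesis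
        using IH(5)[of ?T] T \<open>?T \<subseteq> carrier B\<close> by simp
    qed
    ultimately show ?thesis
      using IH(2,3) 2 shift_lamps[OF m] by (intro exI[of _ "shift B m f"] exI[of _ "m # ms"]) auto
  qed
qed

lemma word_prod_lamps:
  assumes "set as \<subseteq> SA" "word_prod W ws = (f, b)" "f \<in> lamps" "b \<in> carrier B"
  shows "word_prod W (map (wreath_lamp A B) as @ ws) =
    (f(\<one>\<^bsub>B\<^esub> := word_prod A as \<otimes>\<^bsub>A\<^esub> f \<one>\<^bsub>B\<^esub>), b)"
  using assms
proof (induction as)
  case Nil
  then show ?case using lamps_closed by simp
next
  case (Cons a as)
  have cl: "word_prod A as \<in> carrier A" "f \<one>\<^bsub>B\<^esub> \<in> carrier A"
    using Cons.prems lamps_closed by (auto simp: A.word_closed)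
  define F where "F = f(\<one>\<^bsub>B\<^esub> := word_prod A as \<otimes>\<^bsub>A\<^esub> f \<one>\<^bsub>B\<^esub>)"
  have "word_prod W (map (wreath_lamp A B) as @ ws) = (F, b)"
    unfolding F_def using Cons.prems by (intro Cons.IH) auto
  then have "word_prod W (map (wreath_lamp A B) (a # as) @ ws) = wreath_lamp A B a \<otimes>\<^bsub>W\<^esub> (F, b)"
    by simp
  also have "\<dots> = (F(\<one>\<^bsub>B\<^esub> := a \<otimes>\<^bsub>A\<^esub> F \<one>\<^bsub>B\<^esub>), b)"
    using Cons.prems cl by (intro lamp_mult) (auto simp: F_def update_lamps simp del: fun_upd_apply)
  also have "F(\<one>\<^bsub>B\<^esub> := a \<otimes>\<^bsub>A\<^esub> F \<one>\<^bsub>B\<^esub>) = f(\<one>\<^bsub>B\<^esub> := word_prod A (a # as) \<otimes>\<^bsub>A\<^esub> f \<one>\<^bsub>B\<^esub>)"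
    using Cons.prems cl by (simp add: F_def A.m_assoc A.gen_closed)
  finally show ?case .
qed

text \<open>The upper bound for word length: write each lamp by a shortest word when the path first
  meets it, then move on.\<close>

lemma path_imp_word:
  assumes "set ms \<subseteq> M" "f \<in> lamps" "supp f \<subseteq> visits B \<one>\<^bsub>B\<^esub> ms"
  shows "\<exists>ws. set ws \<subseteq> gens \<and> word_prod W ws = (f, word_prod B ms) \<and>
    length ws = length ms + cost f"
  using assms
proof (induction ms arbitrary: f)
  case Nil
  have f: "\<And>x. x \<in> carrier B \<Longrightarrow> f x \<in> carrier A" "f \<in> extensional (carrier B)"
    using Nil by (auto simp: lamps_iff)
  obtain as where as: "set as \<subseteq> SA" "length as = word_length A SA (f \<one>\<^bsub>B\<^esub>)"
    "word_prod A as = f \<one>\<^bsub>B\<^esub>"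
    using A.word_length_witness[OF f(1)[OF B.one_closed]] by blast
  have "cost f = length as"
    using cost_superset[of "{\<one>\<^bsub>B\<^esub>}" f] Nil as by simp
  moreover have "word_prod W (map (wreath_lamp A B) as @ []) = (f, \<one>\<^bsub>B\<^esub>)"
    using word_prod_lamps[OF as(1) _ one_lamps, of "[]" "\<one>\<^bsub>B\<^esub>"] Nil f as(3)
    by (auto simp: one_W fun_eq_iff extensional_def supp_def)
  ultimately show ?case
    using as(1) by (intro exI[of _ "map (wreath_lamp A B) as @ []"]) (auto simp: gens_def)
next
  case (Cons m ms)
  have m: "m \<in> carrier B" "m \<in> M" and ms: "set ms \<subseteq> carrier B" "set ms \<subseteq> M"
    using Cons.prems by auto
  have f1: "f \<one>\<^bsub>B\<^esub> \<in> carrier A" and fe: "f \<in> extensional (carrier B)"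
    using Cons.prems lamps_closed by (auto simp: lamps_iff)
  obtain as where as: "set as \<subseteq> SA" "length as = word_length A SA (f \<one>\<^bsub>B\<^esub>)"
    "word_prod A as = f \<one>\<^bsub>B\<^esub>"
    using A.word_length_witness[OF f1] by blast
  \<comment> \<open>The lamp at the identity is finished and therefore cleared; \<open>?g\<close> is
    what remains to be written, seen from the next vertex.\<close>
  let ?f = "f(\<one>\<^bsub>B\<^esub> := \<one>\<^bsub>A\<^esub>)"
  let ?g = "shift B (inv\<^bsub>B\<^esub> m) ?f"
  have f_lamps: "?f \<in> lamps"
    using update_lamps Cons.prems by simp
  then have g_lamps: "?g \<in> lamps"
    using shift_lamps m by simp
  have g: "shift B m ?g = ?f"
    using f_lamps lamps_iff by (intro shift_inv_shift m(1)) blast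
  have "supp ?f \<subseteq> (\<otimes>\<^bsub>B\<^esub>) m ` visits B \<one>\<^bsub>B\<^esub> ms"
    using Cons.prems(3) B.visits_translate[OF m(1) B.one_closed ms(1)] m
    by (auto simp: supp_def)
  then have sub: "(\<otimes>\<^bsub>B\<^esub>) m ` supp ?g \<subseteq> (\<otimes>\<^bsub>B\<^esub>) m ` visits B \<one>\<^bsub>B\<^esub> ms"
    using supp_shift[OF m(1), of ?g] g by simp
  have "supp ?g \<subseteq> visits B \<one>\<^bsub>B\<^esub> ms"
  proof
    fix x assume x: "x \<in> supp ?g"
    with sub obtain y where "y \<in> visits B \<one>\<^bsub>B\<^esub> ms" "m \<otimes>\<^bsub>B\<^esub> x = m \<otimes>\<^bsub>B\<^esub> y"
      by blast
    moreover from this have "y \<in> carrier B"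
      using B.visits_closed[OF B.one_closed ms(1)] by blast
    moreover have "x \<in> carrier B"
      using x supp_closed by blast
    ultimately show "x \<in> visits B \<one>\<^bsub>B\<^esub> ms"
      using m(1) by simp
  qed
  with Cons.IH[OF ms(2) g_lamps] obtain ws where ws: "set ws \<subseteq> gens"
    "word_prod W ws = (?g, word_prod B ms)" "length ws = length ms + cost ?g"
    by blast
  let ?ws = "map (wreath_lamp A B) as @ wreath_base A B m # ws"
  have "word_prod W (wreath_base A B m # ws) = (?f, word_prod B (m # ms))"
    using ws(2) base_mult[OF m(1) g_lamps] g by simp
  then have "word_prod W ?ws = (f, word_prod B (m # ms))"
    using word_prod_lamps[OF as(1) _ f_lamps] m ms f1 as(3) by simp
  moreover have "cost f = word_length A SA (f \<one>\<^bsub>B\<^esub>) + cost ?g"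
  proof -
    have "cost ?g = (\<Sum>x\<in>supp ?f. word_length A SA (?f x))"
      using sum_shift[OF m(1) supp_closed, of ?g ?g] supp_shift[OF m(1), of ?g] g
      by (simp add: cost_def del: fun_upd_apply)
    also have "supp ?f = supp f - {\<one>\<^bsub>B\<^esub>}"
      by (auto simp: supp_def)
    also have "(\<Sum>x\<in>supp f - {\<one>\<^bsub>B\<^esub>}. word_length A SA (?f x))
        = (\<Sum>x\<in>supp f - {\<one>\<^bsub>B\<^esub>}. word_length A SA (f x))"
      by (intro sum.cong) auto
    also have "word_length A SA (f \<one>\<^bsub>B\<^esub>) + \<dots>
        = (\<Sum>x\<in>insert \<one>\<^bsub>B\<^esub> (supp f). word_length A SA (f x))"
      using finite_supp[OF Cons.prems(2)] by (simp add: sum.insert_remove)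
    also have "\<dots> = cost f"
      using finite_supp[OF Cons.prems(2)] supp_closed by (subst cost_superset) auto
    finally show ?thesis by (rule sym)
  qed
  ultimately show ?case
    using ws as m by (intro exI[of _ ?ws]) (auto simp: gens_def)
qed

text \<open>An optimal tour fed into \<open>path_imp_word\<close> gives one inequality,
  \<open>word_imp_path\<close> with \<open>T\<close> the support the other.\<close>

lemma word_length_W:
  assumes f: "f \<in> lamps" and b: "b \<in> carrier B"
  shows "word_length W gens (f, b) = cost f + tour B M (supp f) b"
  unfolding word_length_def
proof (rule Least_equality)
  obtain ms where ms: "set ms \<subseteq> M" "length ms = tour B M (supp f) b" "word_prod B ms = b"
    "supp f \<subseteq> visits B \<one>\<^bsub>B\<^esub> ms"
    using B.tour_witness[OF finite_supp[OF f] supp_closed b] by blast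
  then show "\<exists>ws. set ws \<subseteq> gens \<and> length ws = cost f + tour B M (supp f) b \<and>
      word_prod W ws = (f, b)"
    using path_imp_word[OF ms(1) f ms(4)] by (auto simp: ac_simps)
next
  fix n
  assume "\<exists>ws. set ws \<subseteq> gens \<and> length ws = n \<and> word_prod W ws = (f, b)"
  then obtain ws where ws: "set ws \<subseteq> gens" "length ws = n" "word_prod W ws = (f, b)"
    by blast
  from word_imp_path[OF ws(1)] ws(3) obtain ms where ms: "b = word_prod B ms" "set ms \<subseteq> M"
    "supp f \<subseteq> visits B \<one>\<^bsub>B\<^esub> ms"
    "\<And>T. finite T \<Longrightarrow> T \<subseteq> carrier B \<Longrightarrow>
      (\<Sum>x\<in>T. word_length A SA (f x)) + length ms \<le> length ws"
    by auto
  show "cost f + tour B M (supp f) b \<le> n"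
    using ms(4)[OF finite_supp[OF f] supp_closed] B.tour_le[OF ms(2) _ ms(3)] ms(1) ws(2)
    by (simp add: cost_def)
qed

lemma mult_W_apply:
  assumes "f \<in> lamps" "f' \<in> lamps" "b \<in> carrier B" "b' \<in> carrier B"
  shows "\<exists>f''. (f, b) \<otimes>\<^bsub>W\<^esub> (f', b') = (f'', b \<otimes>\<^bsub>B\<^esub> b') \<and> f'' \<in> lamps \<and>
    (\<forall>x\<in>carrier B. f'' x = f x \<otimes>\<^bsub>A\<^esub> f' (inv\<^bsub>B\<^esub> b \<otimes>\<^bsub>B\<^esub> x))"
proof -
  let ?f = "\<lambda>x\<in>carrier B. f x \<otimes>\<^bsub>A\<^esub> shift B b f' x"
  have s: "shift B b f' \<in> lamps"
    using shift_lamps assms by blast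
  have "supp ?f \<subseteq> supp f \<union> supp (shift B b f')"
    by (auto simp: supp_def)
  then have "finite (supp ?f)"
    using finite_subset finite_supp[OF assms(1)] finite_supp[OF s] by blast
  then have "?f \<in> lamps"
    using lamps_closed[OF s] lamps_closed[OF assms(1)] by (auto simp: lamps_iff)
  then show ?thesis
    by (intro exI[of _ ?f]) (simp add: mult_W shift_apply)
qed

text \<open>What depth in the wreath product demands of the base alone: \<open>F\<close> plays the
  support of the lamps and \<open>b\<close> the end point. Keeping the visited points in
  \<open>F\<close> prevents short words from lighting new lamps.\<close>

definition deep where
  "deep n F b \<longleftrightarrow> finite F \<and> F \<subseteq> carrier B \<and> b \<in> carrier B \<and>
    (\<forall>ms. set ms \<subseteq> M \<and> length ms \<le> n \<longrightarrow>
      visits B b ms \<subseteq> F \<and> tour B M F (b \<otimes>\<^bsub>B\<^esub> word_prod B ms) \<le> tour B M F b)"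

text \<open>Put the same deep element \<open>g\<close> of \<open>A\<close> on every point of
  \<open>F\<close>. Within \<open>n\<close> letters no lamp gets longer, no lamp outside
  \<open>F\<close> is reached, and the tour does not get longer.\<close>

lemma deep_imp_unbounded:
  assumes A: "unbounded_depth A SA" "carrier A \<noteq> {\<one>\<^bsub>A\<^esub>}" and deep: "\<And>n. \<exists>F b. deep n F b"
  shows "unbounded_depth W gens"
proof -
  have "\<exists>g\<in>carrier W. \<forall>ws. set ws \<subseteq> gens \<and> length ws \<le> n \<longrightarrow>
    word_length W gens (g \<otimes>\<^bsub>W\<^esub> word_prod W ws) \<le> word_length W gens g" for n
  proof -
    obtain F b where "deep n F b"
      using deep by blast
    then have F: "finite F" "F \<subseteq> carrier B" and b: "b \<in> carrier B"
      and near: "\<And>ms. set ms \<subseteq> M \<Longrightarrow> length ms \<le> n \<Longrightarrow> visits B b ms \<subseteq> F"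
      and tour: "\<And>ms. set ms \<subseteq> M \<Longrightarrow> length ms \<le> n \<Longrightarrow>
        tour B M F (b \<otimes>\<^bsub>B\<^esub> word_prod B ms) \<le> tour B M F b"
      by (auto simp: deep_def)
    have "\<forall>n. \<exists>g\<in>carrier A. \<forall>as. set as \<subseteq> SA \<and> length as \<le> n \<longrightarrow>
      word_length A SA (g \<otimes>\<^bsub>A\<^esub> word_prod A as) \<le> word_length A SA g"
      by (rule iffD1[OF unbounded_depth_iff A(1)]) (simp add: A.gen_closed)
    \<comment> \<open>\<open>Suc n\<close> admits a word of length one even for
      \<open>n = 0\<close>; this makes \<open>g\<close> nontrivial below.\<close>
    from spec[OF this, of "Suc n"] obtain g where g: "g \<in> carrier A"
      "\<And>as. set as \<subseteq> SA \<Longrightarrow> length as \<le> Suc n \<Longrightarrow>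
        word_length A SA (g \<otimes>\<^bsub>A\<^esub> word_prod A as) \<le> word_length A SA g"
      by blast
    have g_ne: "g \<noteq> \<one>\<^bsub>A\<^esub>"
    proof
      assume "g = \<one>\<^bsub>A\<^esub>"
      obtain s where s: "s \<in> SA" "s \<noteq> \<one>\<^bsub>A\<^esub>"
        using A.ex_nontrivial_gen[OF A(2)] by blast
      then have "word_length A SA s = 0"
        using g(2)[of "[s]"] by (auto simp: \<open>g = \<one>\<^bsub>A\<^esub>\<close>)
      then show False
        using s A.word_length_eq_0 by auto
    qed
    define f where "f = (\<lambda>x\<in>carrier B. if x \<in> F then g else \<one>\<^bsub>A\<^esub>)"
    have supp_f: "supp f = F"
      using F(2) g_ne by (auto simp: supp_def f_def)
    then have f: "f \<in> lamps"
      using g(1) F(1) by (auto simp: lamps_iff f_def)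
    have "word_length W gens ((f, b) \<otimes>\<^bsub>W\<^esub> word_prod W ws) \<le> word_length W gens (f, b)"
      if ws: "set ws \<subseteq> gens" "length ws \<le> n" for ws
    proof -
      from word_imp_path[OF ws(1)] obtain f' ms where
        ws_eq: "word_prod W ws = (f', word_prod B ms)" and
        f': "f' \<in> lamps" "supp f' \<subseteq> visits B \<one>\<^bsub>B\<^esub> ms" and ms: "set ms \<subseteq> M" and
        len: "\<forall>T. finite T \<and> T \<subseteq> carrier B \<longrightarrow>
          (\<Sum>x\<in>T. word_length A SA (f' x)) + length ms \<le> length ws"
        by (elim exE conjE)
      \<comment> \<open>The empty set as \<open>T\<close> bounds the number of moves.\<close>
      have ms': "set ms \<subseteq> carrier B" "length ms \<le> n"
        using ms spec[OF len, of "{}"] ws(2) by auto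
      obtain f'' where f'': "(f, b) \<otimes>\<^bsub>W\<^esub> word_prod W ws = (f'', b \<otimes>\<^bsub>B\<^esub> word_prod B ms)"
        "f'' \<in> lamps" "\<forall>x\<in>carrier B. f'' x = f x \<otimes>\<^bsub>A\<^esub> f' (inv\<^bsub>B\<^esub> b \<otimes>\<^bsub>B\<^esub> x)"
        using mult_W_apply[OF f f'(1) b B.word_prod_closed[OF ms'(1)]] ws_eq
        by (elim exE conjE) simp
      have "supp f'' \<subseteq> F"
      proof
        fix x assume x: "x \<in> supp f''"
        then have xB: "x \<in> carrier B"
          by (simp add: supp_def)
        \<comment> \<open>A new lamp can only be lit on the path from \<open>b\<close>, and this
          path stays in \<open>F\<close>.\<close>
        show "x \<in> F"
        proof (rule ccontr)
          assume "x \<notin> F"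
          then have "f'' x = f' (inv\<^bsub>B\<^esub> b \<otimes>\<^bsub>B\<^esub> x)"
            using bspec[OF f''(3) xB] xB b lamps_closed[OF f'(1)] by (simp add: f_def)
          then have "inv\<^bsub>B\<^esub> b \<otimes>\<^bsub>B\<^esub> x \<in> visits B \<one>\<^bsub>B\<^esub> ms"
            using x xB b f'(2) by (auto simp: supp_def)
          then have "b \<otimes>\<^bsub>B\<^esub> (inv\<^bsub>B\<^esub> b \<otimes>\<^bsub>B\<^esub> x) \<in> visits B b ms"
            using B.visits_translate[OF b B.one_closed ms'(1)] b by auto
          then have "x \<in> visits B b ms"
            using b xB by (simp add: B.m_assoc[symmetric])
          then show False
            using near[OF ms ms'(2)] \<open>x \<notin> F\<close> by blast
        qed
      qed
      then have cost'': "cost f'' = (\<Sum>x\<in>F. word_length A SA (f'' x))"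
        using cost_superset F by blast
      also have "\<dots> \<le> (\<Sum>x\<in>F. word_length A SA (f x))"
      proof (rule sum_mono)
        fix x assume x: "x \<in> F"
        let ?y = "inv\<^bsub>B\<^esub> b \<otimes>\<^bsub>B\<^esub> x"
        have y: "?y \<in> carrier B"
          using x F b by auto
        \<comment> \<open>With \<open>T\<close> a single point, the lamp is changed by an element of
          length at most \<open>n\<close>, within the depth of \<open>g\<close>.\<close>
        have "word_length A SA (f' ?y) \<le> n"
          using spec[OF len, of "{?y}"] y ws(2) by simp
        moreover obtain as where "set as \<subseteq> SA" "length as = word_length A SA (f' ?y)"
          "word_prod A as = f' ?y"
          using A.word_length_witness[OF lamps_closed[OF f'(1) y]] by blast
        ultimately show "word_length A SA (f'' x) \<le> word_length A SA (f x)"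
          using g(2)[of as] x F bspec[OF f''(3), of x] by (auto simp: f_def)
      qed
      also have "\<dots> = cost f"
        by (simp add: cost_def supp_f)
      finally have "cost f'' \<le> cost f" .
      \<comment> \<open>Lamps may have been switched off, which only shrinks the set that the tour
        has to cover.\<close>
      moreover have "tour B M (supp f'') (b \<otimes>\<^bsub>B\<^esub> word_prod B ms) \<le> tour B M F b"
        using tour[OF ms ms'(2)] B.tour_mono[OF \<open>supp f'' \<subseteq> F\<close> F] b ms'(1)
        by (meson B.m_closed B.word_prod_closed order_trans)
      ultimately show ?thesis
        using b ms' by (simp add: f''(1) word_length_W f f''(2) supp_f)
    qed
    moreover have "(f, b) \<in> carrier W"
      using f b by (simp add: carrier_W)
    ultimately show ?thesis
      by blast
  qed
  then show ?thesis
    by (intro iffD2[OF unbounded_depth_iff] allI) (rule gens_r_one)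
qed

lemma inverse_word:
  assumes "set ms \<subseteq> M"
  shows "\<exists>ms'. set ms' \<subseteq> M \<and> length ms' = length ms \<and> word_prod B ms' = inv\<^bsub>B\<^esub> (word_prod B ms)"
  using assms
proof (induction ms)
  case (Cons m ms)
  then obtain ms' where "set ms' \<subseteq> M" "length ms' = length ms"
    "word_prod B ms' = inv\<^bsub>B\<^esub> (word_prod B ms)"
    by auto
  then show ?case
    using Cons.prems by (intro exI[of _ "ms' @ [inv\<^bsub>B\<^esub> m]"])
      (auto simp: B.word_prod_append B.gens_inv B.inv_mult_group B.word_closed)
qed simp

lemma visits_prefix:
  assumes "set ms \<subseteq> M" "u \<in> carrier B" "x \<in> visits B u ms"
  shows "\<exists>ms'. set ms' \<subseteq> M \<and> length ms' \<le> length ms \<and> x = u \<otimes>\<^bsub>B\<^esub> word_prod B ms'"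
  using assms
proof (induction ms arbitrary: u)
  case Nil
  then show ?case by simp
next
  case (Cons m ms)
  show ?case
  proof (cases "x = u")
    case True
    then show ?thesis using Cons.prems by (intro exI[of _ "[]"]) simp
  next
    case False
    then obtain ms' where "set ms' \<subseteq> M" "length ms' \<le> length ms"
      "x = u \<otimes>\<^bsub>B\<^esub> m \<otimes>\<^bsub>B\<^esub> word_prod B ms'"
      using Cons.IH[of "u \<otimes>\<^bsub>B\<^esub> m"] Cons.prems by auto
    then show ?thesis
      using Cons.prems by (intro exI[of _ "m # ms'"]) (auto simp: B.m_assoc B.word_closed)
  qed
qed

text \<open>Take the support of a deep element as \<open>F\<close>. Were a point near
  \<open>b\<close> unlit, then walking there, lighting it with one letter and walking back would
  raise the lamp cost without shortening the tour.\<close>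

lemma unbounded_imp_deep:
  assumes A: "carrier A \<noteq> {\<one>\<^bsub>A\<^esub>}" and unbounded: "unbounded_depth W gens"
  shows "\<exists>F b. deep n F b"
proof -
  have "\<forall>n. \<exists>g\<in>carrier W. \<forall>ws. set ws \<subseteq> gens \<and> length ws \<le> n \<longrightarrow>
    word_length W gens (g \<otimes>\<^bsub>W\<^esub> word_prod W ws) \<le> word_length W gens g"
    by (rule iffD1[OF unbounded_depth_iff unbounded]) (rule gens_r_one)
  \<comment> \<open>\<open>n\<close> letters to reach a point, one to change its lamp, and
    \<open>n\<close> to return.\<close>
  from spec[OF this, of "2 * n + 1"] obtain g where "g \<in> carrier W"
    "\<forall>ws. set ws \<subseteq> gens \<and> length ws \<le> 2 * n + 1 \<longrightarrow>
    word_length W gens (g \<otimes>\<^bsub>W\<^esub> word_prod W ws) \<le> word_length W gens g"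
    by blast
  moreover obtain f b where "g = (f, b)"
    by (cases g)
  ultimately have f: "f \<in> lamps" and b: "b \<in> carrier B" and
    short: "\<And>ws. set ws \<subseteq> gens \<Longrightarrow> length ws \<le> 2 * n + 1 \<Longrightarrow>
      word_length W gens ((f, b) \<otimes>\<^bsub>W\<^esub> word_prod W ws) \<le> word_length W gens (f, b)"
    by (auto simp: carrier_W)
  note fs = finite_supp[OF f] and sc = supp_closed[of f]
  have near: "visits B b ms \<subseteq> supp f" if ms: "set ms \<subseteq> M" "length ms \<le> n" for ms
  proof
    fix x assume "x \<in> visits B b ms"
    then obtain p where p: "set p \<subseteq> M" "length p \<le> n" "x = b \<otimes>\<^bsub>B\<^esub> word_prod B p"
      using visits_prefix[OF ms(1) b] ms(2) by (meson order_trans)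
    obtain p' where p': "set p' \<subseteq> M" "length p' \<le> n" "word_prod B p' = inv\<^bsub>B\<^esub> (word_prod B p)"
      using inverse_word[OF p(1)] p(2) by auto
    have car: "set p \<subseteq> carrier B" "set p' \<subseteq> carrier B"
      using p p' by auto
    let ?y = "word_prod B p"
    have y: "?y \<in> carrier B" and x: "x \<in> carrier B"
      using car b p(3) by simp_all
    show "x \<in> supp f"
    proof (rule ccontr)
      assume notin: "x \<notin> supp f"
      then have fx: "f x = \<one>\<^bsub>A\<^esub>"
        using x by (simp add: supp_def)
      obtain a where a: "a \<in> SA" "a \<noteq> \<one>\<^bsub>A\<^esub>"
        using A.ex_nontrivial_gen[OF A] by blast
      define f' where "f' = (\<lambda>z\<in>carrier B. if z = ?y then a else \<one>\<^bsub>A\<^esub>)"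
      have supp_f': "supp f' = {?y}"
        using y a by (auto simp: f'_def supp_def)
      then have f': "f' \<in> lamps"
        using a by (auto simp: lamps_iff f'_def)
      have "?y \<in> visits B \<one>\<^bsub>B\<^esub> p"
        using B.end_in_visits[OF B.one_closed car(1)] y by simp
      then have "supp f' \<subseteq> visits B \<one>\<^bsub>B\<^esub> (p @ p')"
        using supp_f' car by (simp add: B.visits_append)
      then obtain ws where ws: "set ws \<subseteq> gens" "word_prod W ws = (f', word_prod B (p @ p'))"
        "length ws = length (p @ p') + cost f'"
        using path_imp_word[OF _ f', of "p @ p'"] p(1) p'(1) by auto
      have "cost f' = word_length A SA a"
        unfolding cost_def supp_f' using y by (simp add: f'_def)
      moreover have "word_length A SA a \<le> 1"
        using A.word_length_le[of "[a]"] a by auto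
      ultimately have "length ws \<le> 2 * n + 1"
        using ws(3) p(2) p'(2) by simp
      note le = short[OF ws(1) this]
      have ws_one: "word_prod W ws = (f', \<one>\<^bsub>B\<^esub>)"
        using ws(2) car p'(3) y by (simp add: B.word_prod_append)
      obtain f'' where f'': "(f, b) \<otimes>\<^bsub>W\<^esub> word_prod W ws = (f'', b \<otimes>\<^bsub>B\<^esub> \<one>\<^bsub>B\<^esub>)" "f'' \<in> lamps"
        "\<forall>z\<in>carrier B. f'' z = f z \<otimes>\<^bsub>A\<^esub> f' (inv\<^bsub>B\<^esub> b \<otimes>\<^bsub>B\<^esub> z)"
        using mult_W_apply[OF f f' b B.one_closed] ws_one
        by (elim exE conjE) simp
      have "inv\<^bsub>B\<^esub> b \<otimes>\<^bsub>B\<^esub> z = ?y \<longleftrightarrow> z = x" if "z \<in> carrier B" for z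
        using that b y p(3) B.inv_solve_left' by metis
      then have f''_eq: "f'' z = (if z = x then a else f z)" if "z \<in> carrier B" for z
        using that bspec[OF f''(3) that] b a fx lamps_closed[OF f that] by (auto simp: f'_def)
      have supp_f'': "supp f'' = insert x (supp f)"
        using f''_eq x a fx by (auto simp: supp_def split: if_splits)
      have "cost f'' = word_length A SA a + cost f"
      proof -
        have "cost f'' = word_length A SA a + (\<Sum>z\<in>supp f. word_length A SA (f'' z))"
          using fs notin x by (simp add: cost_def supp_f'' f''_eq)
        also have "(\<Sum>z\<in>supp f. word_length A SA (f'' z)) = cost f"
          unfolding cost_def using notin sc f''_eq by (intro sum.cong) auto
        finally show ?thesis .
      qed
      moreover have "word_length A SA a \<noteq> 0"
        using A.word_length_eq_0 a by auto
      moreover have "tour B M (supp f) b \<le> tour B M (supp f'') b"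
        using B.tour_mono[of "supp f" "supp f''" b] fs sc x b by (simp add: supp_f'' subset_insertI)
      moreover have "cost f'' + tour B M (supp f'') b \<le> cost f + tour B M (supp f) b"
        using le b f f''(2) by (simp add: f''(1) word_length_W)
      ultimately show False
        by simp
    qed
  qed
  \<comment> \<open>Words of moves alone leave the lamps unchanged, so the lamp costs
    cancel.\<close>
  moreover have "tour B M (supp f) (b \<otimes>\<^bsub>B\<^esub> word_prod B ms) \<le> tour B M (supp f) b"
    if ms: "set ms \<subseteq> M" "length ms \<le> n" for ms
  proof -
    obtain ws where ws: "set ws \<subseteq> gens"
      "word_prod W ws = ((\<lambda>x\<in>carrier B. \<one>\<^bsub>A\<^esub>), word_prod B ms)" "length ws = length ms"
      using path_imp_word[OF ms(1) one_lamps] by (auto simp: supp_one cost_def)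
    have mb: "word_prod B ms \<in> carrier B"
      using ms by (simp add: B.word_closed)
    have "(f, b) \<otimes>\<^bsub>W\<^esub> word_prod W ws = (f, b \<otimes>\<^bsub>B\<^esub> word_prod B ms)"
      using f b by (auto simp: ws(2) mult_W shift_apply lamps_iff fun_eq_iff extensional_def)
    then show ?thesis
      using short[OF ws(1)] ws(3) ms(2) f b mb by (simp add: word_length_W)
  qed
  ultimately have "deep n (supp f) b"
    using fs sc b by (simp add: deep_def)
  then show ?thesis
    by blast
qed

end

section \<open>Tours in the free product and the Hamiltonian difference\<close>

text \<open>The maximum runs over a finite nonempty set, hence is attained. The difference can be
  negative: it is -1 for a group of order two.\<close>

lemma (in generated_group) hamiltonian_difference:
  assumes "finite (carrier G)" "carrier G \<noteq> {\<one>}"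
  shows "\<exists>g\<in>carrier G - {\<one>}. hamiltonian_difference G S = int (TS G S \<one> g) - int (TS G S \<one> \<one>)"
    and "g \<in> carrier G - {\<one>} \<Longrightarrow>
      int (TS G S \<one> g) - int (TS G S \<one> \<one>) \<le> hamiltonian_difference G S"
proof -
  let ?T = "TS G S \<one> ` (carrier G - {\<one>})"
  have T: "finite ?T" "?T \<noteq> {}"
    using assms one_closed by auto
  show "\<exists>g\<in>carrier G - {\<one>}. hamiltonian_difference G S = int (TS G S \<one> g) - int (TS G S \<one> \<one>)"
    using Max_in[OF T] by (auto simp: hamiltonian_difference_def)
  show "int (TS G S \<one> g) - int (TS G S \<one> \<one>) \<le> hamiltonian_difference G S"
    if "g \<in> carrier G - {\<one>}"
    using Max_ge[OF T(1), of "TS G S \<one> g"] that by (simp add: hamiltonian_difference_def)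
qed

section \<open>Moving the end point of a tour in the free product\<close>

locale finite_free_product = free_product_gens H SH K SK
  for H :: "('h, 'm) monoid_scheme" and SH and K :: "('k, 'n) monoid_scheme" and SK +
  assumes finite_H: "finite (carrier H)" and finite_K: "finite (carrier K)"
    and nontrivial_H: "carrier H \<noteq> {\<one>\<^bsub>H\<^esub>}" and nontrivial_K: "carrier K \<noteq> {\<one>\<^bsub>K\<^esub>}"
begin

sublocale left: free_factor B M H SH "free_inl H" "side_proj True"
proof unfold_locales
  show "free_inl H ` SH \<subseteq> M"
    by (auto simp: M_def)
  show "side_proj True b = b" if "b \<in> free_inl H ` carrier H" for b
    using that by (auto simp: free_inl_def)
qed (use side_proj_in side_proj_move free_inl_hom inj_free_inl finite_H in simp_all)

sublocale right: free_factor B M K SK "free_inr K" "side_proj False"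
proof unfold_locales
  show "free_inr K ` SK \<subseteq> M"
    by (auto simp: M_def)
  show "side_proj False b = b" if "b \<in> free_inr K ` carrier K" for b
    using that by (auto simp: free_inr_def)
qed (use side_proj_in side_proj_move free_inr_hom inj_free_inr finite_K in simp_all)

abbreviation "ham_H \<equiv> hamiltonian_difference H SH"
abbreviation "ham_K \<equiv> hamiltonian_difference K SK"

lemma swap_left:
  assumes F: "finite F" "F \<subseteq> reduced_words H K"
    and w: "w \<in> reduced_words H K" "w = [] \<or> \<not> isl (last w)"
    and cov: "\<And>v. v \<in> free_inl H ` carrier H \<Longrightarrow> w \<otimes>\<^bsub>B\<^esub> v \<in> F"
    and x: "x \<in> carrier H" and y: "y \<in> carrier H"
  shows "tour B M F (w \<otimes>\<^bsub>B\<^esub> free_inl H y) + TS H SH \<one>\<^bsub>H\<^esub> x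
    \<le> tour B M F (w \<otimes>\<^bsub>B\<^esub> free_inl H x) + TS H SH \<one>\<^bsub>H\<^esub> y"
proof (rule left.tour_swap)
  show "side_proj True (inv\<^bsub>B\<^esub> w) = \<one>\<^bsub>B\<^esub>"
    using side_proj_inv w by auto
  show "(\<otimes>\<^bsub>B\<^esub>) w ` left.C \<subseteq> F"
    using cov by (auto simp: left.C_def)
qed (use F w x y in simp_all)

lemma swap_right:
  assumes F: "finite F" "F \<subseteq> reduced_words H K"
    and w: "w \<in> reduced_words H K" "w = [] \<or> isl (last w)"
    and cov: "\<And>v. v \<in> free_inr K ` carrier K \<Longrightarrow> w \<otimes>\<^bsub>B\<^esub> v \<in> F"
    and x: "x \<in> carrier K" and y: "y \<in> carrier K"
  shows "tour B M F (w \<otimes>\<^bsub>B\<^esub> free_inr K y) + TS K SK \<one>\<^bsub>K\<^esub> x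
    \<le> tour B M F (w \<otimes>\<^bsub>B\<^esub> free_inr K x) + TS K SK \<one>\<^bsub>K\<^esub> y"
proof (rule right.tour_swap)
  show "side_proj False (inv\<^bsub>B\<^esub> w) = \<one>\<^bsub>B\<^esub>"
    using side_proj_inv w by auto
  show "(\<otimes>\<^bsub>B\<^esub>) w ` right.C \<subseteq> F"
    using cov by (auto simp: right.C_def)
qed (use F w x y in simp_all)

lemma snoc_left:
  assumes "w \<in> reduced_words H K" "w = [] \<or> \<not> isl (last w)" "h \<in> carrier H - {\<one>\<^bsub>H\<^esub>}"
  shows "w \<otimes>\<^bsub>B\<^esub> free_inl H h = w @ [Inl h]" "w @ [Inl h] \<in> reduced_words H K"
proof -
  show "w @ [Inl h] \<in> reduced_words H K"
    using assms by (auto simp: reduced_words_def successively_append_iff)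
  from free_mult_reduced[OF this] show "w \<otimes>\<^bsub>B\<^esub> free_inl H h = w @ [Inl h]"
    using assms by (simp add: free_inl_def)
qed

lemma snoc_right:
  assumes "w \<in> reduced_words H K" "w = [] \<or> isl (last w)" "k \<in> carrier K - {\<one>\<^bsub>K\<^esub>}"
  shows "w \<otimes>\<^bsub>B\<^esub> free_inr K k = w @ [Inr k]" "w @ [Inr k] \<in> reduced_words H K"
proof -
  show "w @ [Inr k] \<in> reduced_words H K"
    using assms by (auto simp: reduced_words_def successively_append_iff)
  from free_mult_reduced[OF this] show "w \<otimes>\<^bsub>B\<^esub> free_inr K k = w @ [Inr k]"
    using assms by (simp add: free_inr_def)
qed

lemma mult_one_left: "w \<in> reduced_words H K \<Longrightarrow> w \<otimes>\<^bsub>B\<^esub> free_inl H \<one>\<^bsub>H\<^esub> = w"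
  and mult_one_right: "w \<in> reduced_words H K \<Longrightarrow> w \<otimes>\<^bsub>B\<^esub> free_inr K \<one>\<^bsub>K\<^esub> = w"
  using left.emb_one right.emb_one B.r_one[of w] by simp_all

text \<open>Append to \<open>b\<close> a maximising letter of a factor in which \<open>b\<close>
  does not end, then one of the other factor. Each time the coset is entered at the word reached so
  far, so the swap lemmas compare the identity with the maximising letter.\<close>

lemma ball_imp_tour_increase:
  assumes F: "finite F" "F \<subseteq> reduced_words H K" and b: "b \<in> reduced_words H K"
    and cov: "\<And>u v. u \<in> left.C \<union> right.C \<Longrightarrow> v \<in> left.C \<union> right.C \<Longrightarrow> b \<otimes>\<^bsub>B\<^esub> (u \<otimes>\<^bsub>B\<^esub> v) \<in> F"
  shows "\<exists>u\<in>left.C \<union> right.C. \<exists>v\<in>left.C \<union> right.C.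
    int (tour B M F b) + ham_H + ham_K \<le> int (tour B M F (b \<otimes>\<^bsub>B\<^esub> (u \<otimes>\<^bsub>B\<^esub> v)))"
proof -
  obtain h where h: "h \<in> carrier H - {\<one>\<^bsub>H\<^esub>}"
    "ham_H = int (TS H SH \<one>\<^bsub>H\<^esub> h) - int (TS H SH \<one>\<^bsub>H\<^esub> \<one>\<^bsub>H\<^esub>)"
    using H.hamiltonian_difference(1)[OF finite_H nontrivial_H] by blast
  obtain k where k: "k \<in> carrier K - {\<one>\<^bsub>K\<^esub>}"
    "ham_K = int (TS K SK \<one>\<^bsub>K\<^esub> k) - int (TS K SK \<one>\<^bsub>K\<^esub> \<one>\<^bsub>K\<^esub>)"
    using K.hamiltonian_difference(1)[OF finite_K nontrivial_K] by blast
  have hC: "free_inl H h \<in> left.C" and kC: "free_inr K k \<in> right.C"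
    using h k by auto
  have one: "\<one>\<^bsub>B\<^esub> \<in> left.C"
    using left.emb_C[OF H.one_closed] by simp
  have assoc: "b \<otimes>\<^bsub>B\<^esub> u \<otimes>\<^bsub>B\<^esub> v = b \<otimes>\<^bsub>B\<^esub> (u \<otimes>\<^bsub>B\<^esub> v)"
    if "u \<in> left.C \<union> right.C" "v \<in> left.C \<union> right.C" for u v
    using that b left.C_closed right.C_closed B.m_assoc[of b u v] by auto
  have cov1: "b \<otimes>\<^bsub>B\<^esub> u \<in> F" if "u \<in> left.C \<union> right.C" for u
    using cov[OF that, of "\<one>\<^bsub>B\<^esub>"] one that left.C_closed right.C_closed B.r_one[of u] by auto
  show ?thesis
  proof (cases "b = [] \<or> \<not> isl (last b)")
    case True
    let ?c = "b \<otimes>\<^bsub>B\<^esub> free_inl H h"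
    note c = snoc_left[OF b True h(1)]
    have "tour B M F (b \<otimes>\<^bsub>B\<^esub> free_inl H \<one>\<^bsub>H\<^esub>) + TS H SH \<one>\<^bsub>H\<^esub> h
        \<le> tour B M F ?c + TS H SH \<one>\<^bsub>H\<^esub> \<one>\<^bsub>H\<^esub>"
      using h(1) cov1 by (intro swap_left F b True) (auto simp: left.C_def)
    moreover have "tour B M F (?c \<otimes>\<^bsub>B\<^esub> free_inr K \<one>\<^bsub>K\<^esub>) + TS K SK \<one>\<^bsub>K\<^esub> k
        \<le> tour B M F (?c \<otimes>\<^bsub>B\<^esub> free_inr K k) + TS K SK \<one>\<^bsub>K\<^esub> \<one>\<^bsub>K\<^esub>"
    proof (intro swap_right F)
      fix v :: "('h + 'k) list" assume "v \<in> free_inr K ` carrier K"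
      then show "?c \<otimes>\<^bsub>B\<^esub> v \<in> F"
        using cov[of "free_inl H h" v] assoc[of "free_inl H h" v] hC by (simp add: right.C_def)
    qed (use c k in simp_all)
    ultimately have "int (tour B M F b) + ham_H + ham_K
        \<le> int (tour B M F (?c \<otimes>\<^bsub>B\<^esub> free_inr K k))"
      using mult_one_left[OF b] mult_one_right[of ?c] c h(2) k(2) by simp
    then show ?thesis
      using assoc hC kC by (intro bexI[of _ "free_inl H h"] bexI[of _ "free_inr K k"]) auto
  next
    case False
    then have last: "b = [] \<or> isl (last b)"
      by simp
    let ?c = "b \<otimes>\<^bsub>B\<^esub> free_inr K k"
    note c = snoc_right[OF b last k(1)]
    have "tour B M F (b \<otimes>\<^bsub>B\<^esub> free_inr K \<one>\<^bsub>K\<^esub>) + TS K SK \<one>\<^bsub>K\<^esub> k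
        \<le> tour B M F ?c + TS K SK \<one>\<^bsub>K\<^esub> \<one>\<^bsub>K\<^esub>"
      using k(1) cov1 by (intro swap_right F b last) (auto simp: right.C_def)
    moreover have "tour B M F (?c \<otimes>\<^bsub>B\<^esub> free_inl H \<one>\<^bsub>H\<^esub>) + TS H SH \<one>\<^bsub>H\<^esub> h
        \<le> tour B M F (?c \<otimes>\<^bsub>B\<^esub> free_inl H h) + TS H SH \<one>\<^bsub>H\<^esub> \<one>\<^bsub>H\<^esub>"
    proof (intro swap_left F)
      fix v :: "('h + 'k) list" assume "v \<in> free_inl H ` carrier H"
      then show "?c \<otimes>\<^bsub>B\<^esub> v \<in> F"
        using cov[of "free_inr K k" v] assoc[of "free_inr K k" v] kC by (simp add: left.C_def)
    qed (use c h in simp_all)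
    ultimately have "int (tour B M F b) + ham_H + ham_K
        \<le> int (tour B M F (?c \<otimes>\<^bsub>B\<^esub> free_inl H h))"
      using mult_one_right[OF b] mult_one_left[of ?c] c h(2) k(2) by simp
    then show ?thesis
      using assoc hC kC by (intro bexI[of _ "free_inr K k"] bexI[of _ "free_inl H h"]) auto
  qed
qed

section \<open>Tours through balls with respect to the number of letters\<close>

abbreviation "ball n \<equiv> {w \<in> reduced_words H K. length w \<le> n}"

text \<open>Appending a letter of \<open>H\<close> or \<open>K\<close> adds at most
  \<open>ham_H\<close> or \<open>ham_K\<close>. Their sum is at most 0, so any positive gain is used
  up by the next letter and the bound depends on the last letter only.\<close>

lemma tour_ball_le:
  assumes ham: "ham_H + ham_K \<le> 0"
  shows "v \<in> reduced_words H K \<Longrightarrow> length v < n \<Longrightarrow>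
    int (tour B M (ball n) v) \<le> int (tour B M (ball n) []) +
      (if v = [] then 0 else if isl (last v) then max 0 ham_H else max 0 ham_K)"
proof (induction v rule: rev_induct)
  case Nil
  then show ?case by simp
next
  case (snoc x v)
  let ?t = "\<lambda>v. int (tour B M (ball n) v)"
  have F: "finite (ball n)" "ball n \<subseteq> reduced_words H K"
    using finite_reduced[OF finite_H finite_K] by auto
  have v: "v \<in> reduced_words H K" "length v < n"
    using snoc.prems reduced_appendD by auto
  have alt: "v = [] \<or> isl (last v) \<noteq> isl x" and x: "x \<in> letters H K"
    using snoc.prems by (auto simp: reduced_words_def successively_append_iff)
  \<comment> \<open>As \<open>v\<close> is strictly shorter than \<open>n\<close>, there is room for
    one more letter, so the coset to be swapped lies in the ball.\<close>
  have cov: "v \<otimes>\<^bsub>B\<^esub> u \<in> ball n" if "u \<in> reduced_words H K" "length u \<le> 1" for u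
    using length_free_mult[of H K v u] v that B.m_closed[of v u] by simp
  show ?case
  proof (cases x)
    case (Inl h)
    then have h: "h \<in> carrier H - {\<one>\<^bsub>H\<^esub>}" and alt': "v = [] \<or> \<not> isl (last v)"
      using x alt by auto
    have "tour B M (ball n) (v \<otimes>\<^bsub>B\<^esub> free_inl H h) + TS H SH \<one>\<^bsub>H\<^esub> \<one>\<^bsub>H\<^esub>
        \<le> tour B M (ball n) (v \<otimes>\<^bsub>B\<^esub> free_inl H \<one>\<^bsub>H\<^esub>) + TS H SH \<one>\<^bsub>H\<^esub> h"
      using h by (intro swap_left F v alt' cov) (auto simp: free_inl_def)
    then have "?t (v @ [x]) \<le> ?t v + ham_H"
      using H.hamiltonian_difference(2)[OF finite_H nontrivial_H h]
        snoc_left(1)[OF v(1) alt' h] mult_one_left[OF v(1)] Inl by simp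
    then show ?thesis
      using snoc.IH[OF v] alt' ham Inl by (auto split: if_splits)
  next
    case (Inr k)
    then have k: "k \<in> carrier K - {\<one>\<^bsub>K\<^esub>}" and alt': "v = [] \<or> isl (last v)"
      using x alt by auto
    have "tour B M (ball n) (v \<otimes>\<^bsub>B\<^esub> free_inr K k) + TS K SK \<one>\<^bsub>K\<^esub> \<one>\<^bsub>K\<^esub>
        \<le> tour B M (ball n) (v \<otimes>\<^bsub>B\<^esub> free_inr K \<one>\<^bsub>K\<^esub>) + TS K SK \<one>\<^bsub>K\<^esub> k"
      using k by (intro swap_right F v alt' cov) (auto simp: free_inr_def)
    then have "?t (v @ [x]) \<le> ?t v + ham_K"
      using K.hamiltonian_difference(2)[OF finite_K nontrivial_K k]
        snoc_right(1)[OF v(1) alt' k] mult_one_right[OF v(1)] Inr by simp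
    then show ?thesis
      using snoc.IH[OF v] alt' ham Inr by (auto split: if_splits)
  qed
qed

text \<open>At the empty word the cosets of both factors are entered, so a maximising letter of
  either one gains its full difference; if both differences are at most 0, the identity itself
  serves.\<close>

lemma tour_ball_ge:
  assumes "1 \<le> n"
  shows "\<exists>b\<in>reduced_words H K. length b \<le> 1 \<and>
    int (tour B M (ball n) []) + max 0 (max ham_H ham_K) \<le> int (tour B M (ball n) b)"
proof -
  let ?t = "\<lambda>v. int (tour B M (ball n) v)"
  have F: "finite (ball n)" "ball n \<subseteq> reduced_words H K"
    using finite_reduced[OF finite_H finite_K] by auto
  have cov: "[] \<otimes>\<^bsub>B\<^esub> u \<in> ball n" if "u \<in> reduced_words H K" "length u \<le> 1" for u
    using that assms by simp
  obtain h where h: "h \<in> carrier H - {\<one>\<^bsub>H\<^esub>}"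
    "ham_H = int (TS H SH \<one>\<^bsub>H\<^esub> h) - int (TS H SH \<one>\<^bsub>H\<^esub> \<one>\<^bsub>H\<^esub>)"
    using H.hamiltonian_difference(1)[OF finite_H nontrivial_H] by blast
  obtain k where k: "k \<in> carrier K - {\<one>\<^bsub>K\<^esub>}"
    "ham_K = int (TS K SK \<one>\<^bsub>K\<^esub> k) - int (TS K SK \<one>\<^bsub>K\<^esub> \<one>\<^bsub>K\<^esub>)"
    using K.hamiltonian_difference(1)[OF finite_K nontrivial_K] by blast
  have "tour B M (ball n) ([] \<otimes>\<^bsub>B\<^esub> free_inl H \<one>\<^bsub>H\<^esub>) + TS H SH \<one>\<^bsub>H\<^esub> h
      \<le> tour B M (ball n) ([] \<otimes>\<^bsub>B\<^esub> free_inl H h) + TS H SH \<one>\<^bsub>H\<^esub> \<one>\<^bsub>H\<^esub>"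
    using h(1) by (intro swap_left F cov) (auto simp: free_inl_def)
  then have "?t [] + ham_H \<le> ?t [Inl h]"
    using h by (simp add: free_inl_def)
  moreover have "tour B M (ball n) ([] \<otimes>\<^bsub>B\<^esub> free_inr K \<one>\<^bsub>K\<^esub>) + TS K SK \<one>\<^bsub>K\<^esub> k
      \<le> tour B M (ball n) ([] \<otimes>\<^bsub>B\<^esub> free_inr K k) + TS K SK \<one>\<^bsub>K\<^esub> \<one>\<^bsub>K\<^esub>"
    using k(1) by (intro swap_right F cov) (auto simp: free_inr_def)
  then have "?t [] + ham_K \<le> ?t [Inr k]"
    using k by (simp add: free_inr_def)
  ultimately have "\<exists>b\<in>{[], [Inl h], [Inr k]}. ?t [] + max 0 (max ham_H ham_K) \<le> ?t b"
    by (auto simp: max_def)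
  moreover have "{[], [Inl h], [Inr k]} \<subseteq> {b \<in> reduced_words H K. length b \<le> 1}"
    using h(1) k(1) by auto
  ultimately show ?thesis
    by blast
qed

end

section \<open>Depth of the wreath product over the free product\<close>

locale lamplighter = A: generated_group A SA + finite_free_product H SH K SK
  for A :: "('a, 'q) monoid_scheme" and SA
    and H :: "('h, 'm) monoid_scheme" and SH and K :: "('k, 'n) monoid_scheme" and SK
begin

sublocale wr: wreath A SA B M ..

lemma gens_eq: "wr.gens = wreath_gens A H K SA SH SK"
  by (simp only: wr.gens_def) (simp add: wreath_gens_def M_def Let_def image_Un Un_assoc)

text \<open>The increase in \<open>ball_imp_tour_increase\<close> occurs at one of finitely many
  products \<open>u v\<close>, all within a fixed distance \<open>n\<close>. A \<open>b\<close> that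
  is deep to that distance allows no increase.\<close>

lemma deep_imp_ham_le:
  assumes deep: "\<And>n. \<exists>F b. wr.deep n F b"
  shows "ham_H + ham_K \<le> 0"
proof -
  let ?C = "left.C \<union> right.C"
  define P where "P = (\<lambda>(u, v). u \<otimes>\<^bsub>B\<^esub> v) ` (?C \<times> ?C)"
  have "finite P"
    using left.finite_C right.finite_C by (simp add: P_def)
  have "P \<subseteq> carrier B"
    using left.C_closed right.C_closed B.m_closed
    by (fastforce simp: P_def simp del: carrier_free_product mult_free_product)
  then have "\<forall>y\<in>P. \<exists>ms. set ms \<subseteq> M \<and> word_prod B ms = y"
    using B.ex_word by blast
  then obtain g where g: "\<And>y. y \<in> P \<Longrightarrow> set (g y) \<subseteq> M \<and> word_prod B (g y) = y"
    by metis
  \<comment> \<open>A sum instead of a maximum: any common bound on the lengths will do.\<close>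
  define n where "n = (\<Sum>y\<in>P. length (g y))"
  have len: "length (g y) \<le> n" if "y \<in> P" for y
    unfolding n_def using that \<open>finite P\<close> by (intro member_le_sum) auto
  obtain F b where "wr.deep n F b"
    using deep by blast
  then have F: "finite F" "F \<subseteq> carrier B" and b: "b \<in> carrier B"
    and near: "\<And>ms. set ms \<subseteq> M \<Longrightarrow> length ms \<le> n \<Longrightarrow> visits B b ms \<subseteq> F"
    and tour: "\<And>ms. set ms \<subseteq> M \<Longrightarrow> length ms \<le> n \<Longrightarrow>
      tour B M F (b \<otimes>\<^bsub>B\<^esub> word_prod B ms) \<le> tour B M F b"
    unfolding wr.deep_def by blast+
  have in_F: "b \<otimes>\<^bsub>B\<^esub> y \<in> F" if "y \<in> P" for y
    using near[of "g y"] g[OF that] len[OF that] B.end_in_visits[OF b, of "g y"]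
      B.word_closed[of "g y"] by auto
  have "\<exists>u\<in>?C. \<exists>v\<in>?C.
      int (tour B M F b) + ham_H + ham_K \<le> int (tour B M F (b \<otimes>\<^bsub>B\<^esub> (u \<otimes>\<^bsub>B\<^esub> v)))"
  proof (rule ball_imp_tour_increase)
    fix u v assume "u \<in> ?C" "v \<in> ?C"
    then show "b \<otimes>\<^bsub>B\<^esub> (u \<otimes>\<^bsub>B\<^esub> v) \<in> F"
      by (intro in_F) (auto simp: P_def)
  qed (use F b in simp_all)
  then obtain y where "y \<in> P" "int (tour B M F b) + ham_H + ham_K \<le> int (tour B M F (b \<otimes>\<^bsub>B\<^esub> y))"
    by (auto simp: P_def)
  then show ?thesis
    using tour[of "g y"] g[of y] len[of y] by simp
qed

text \<open>The end point found in \<open>tour_ball_ge\<close> reaches the largest value that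
  \<open>tour_ball_le\<close> admits for words shorter than the radius, so no end point near it
  costs more.\<close>

lemma ham_le_imp_deep:
  assumes ham: "ham_H + ham_K \<le> 0"
  shows "\<exists>F b. wr.deep n F b"
proof -
  \<comment> \<open>\<open>b\<close> has at most one letter and \<open>n\<close> moves add at most
    \<open>n\<close>, so the new end points have length at most \<open>n + 1\<close>, strictly below
    the radius as \<open>tour_ball_le\<close> requires.\<close>
  let ?F = "ball (n + 2)"
  obtain b where b: "b \<in> reduced_words H K" "length b \<le> 1"
    "int (tour B M ?F []) + max 0 (max ham_H ham_K) \<le> int (tour B M ?F b)"
    using tour_ball_ge[of "n + 2"] by auto
  have near: "visits B b ms \<subseteq> ball (n + 1)" if "set ms \<subseteq> M" "length ms \<le> n" for ms
  proof
    fix v assume v: "v \<in> visits B b ms"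
    then have "v \<in> reduced_words H K"
      using B.visits_closed[of b ms] b that B.word_closed[of ms] by auto
    then show "v \<in> ball (n + 1)"
      using length_visits[OF that(1) v] that(2) b(2) by simp
  qed
  have "wr.deep n ?F b"
    unfolding wr.deep_def
  proof (intro conjI allI impI)
    show "finite ?F"
      using finite_reduced[OF finite_H finite_K] .
    fix ms assume ms: "set ms \<subseteq> M \<and> length ms \<le> n"
    then show "visits B b ms \<subseteq> ?F"
      using near[of ms] by auto
    let ?v = "b \<otimes>\<^bsub>B\<^esub> word_prod B ms"
    have "?v \<in> visits B b ms"
      using B.end_in_visits[of b ms] b ms B.word_closed[of ms] by simp
    then have "?v \<in> ball (n + 1)"
      using near[of ms] ms by blast
    then have v: "?v \<in> reduced_words H K" "length ?v < n + 2"
      by (simp_all del: mult_free_product)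
    show "tour B M ?F ?v \<le> tour B M ?F b"
      using tour_ball_le[OF ham v] b(3) by (auto split: if_splits)
  qed (use b in auto)
  then show ?thesis
    by blast
qed

end

theorem theoremB:
  fixes A :: "('a, 'm) monoid_scheme"
    and H :: "('h, 'n) monoid_scheme"
    and K :: "('k, 'p) monoid_scheme"
  assumes "Group.group A" and "carrier A \<noteq> {\<one>\<^bsub>A\<^esub>}"
    and "fin_sym_generating A S\<^sub>A" and "unbounded_depth A S\<^sub>A"
    and "Group.group H" and "finite (carrier H)" and "carrier H \<noteq> {\<one>\<^bsub>H\<^esub>}"
    and "fin_sym_generating H S\<^sub>H"
    and "Group.group K" and "finite (carrier K)" and "carrier K \<noteq> {\<one>\<^bsub>K\<^esub>}"
    and "fin_sym_generating K S\<^sub>K"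
  shows "uniformly_bounded_depth (wreath_product A (free_product H K))
           (wreath_gens A H K S\<^sub>A S\<^sub>H S\<^sub>K) \<longleftrightarrow>
         hamiltonian_difference H S\<^sub>H + hamiltonian_difference K S\<^sub>K \<ge> 1"
proof -
  interpret lamplighter A S\<^sub>A H S\<^sub>H K S\<^sub>K
    using assms by (simp add: lamplighter_def generated_group_def generated_group_axioms_def
        finite_free_product_def finite_free_product_axioms_def free_product_gens_def)
  have "unbounded_depth wr.W wr.gens \<longleftrightarrow> ham_H + ham_K \<le> 0"
    using wr.unbounded_imp_deep wr.deep_imp_unbounded deep_imp_ham_le ham_le_imp_deep assms
    by metis
  \<comment> \<open>The differences are integers, so a sum that is not at most 0 is at least
    1.\<close>
  then show ?thesis
    by (auto simp: uniformly_bounded_depth_def gens_eq)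
qed

end
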